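(* For all integers $k,d\ge 1$ with $d>2k$, one has $$\mathrm{SOCF}_{2k+1,d}=t^0\,\Sigma_{2k}+t^1\,\Sigma_{2k}+\cdots+t^{d-2k}\,\Sigma_{2k}.$$ Moreover $\operatorname{sxdeg}(\mathrm{SOCF}_{2k+1,d})=k+1$.
   Context: $\Sigma_{2k}\subset\mathbb{R}[t]$ is the set of sums of squares of polynomials that have degree $\le 2k$ (equivalently, polynomials of degree $\le 2k$ that are non-negative on $\mathbb{R}$). For a finite set $J\subset\{0,1,2,\dots\}$, $\mathrm{CP}(J)$ is the cone of all $p\in\mathbb{R}[t]$ with $p\ge 0$ on $\mathbb{R}_+=[0,\infty[$ and $\operatorname{supp}(p)\subseteq J$, where $\operatorname{supp}(p)$ is the set of exponents of monomials occurring in $p$ with non-zero coefficient. The cone of sums of copositive fewnomials is $$\mathrm{SOCF}_{k,d}=\sum_{J\subseteq\{0,\dots,d\},\ |J|=k}\mathrm{CP}(J)$$ (Minkowski sum), a convex cone in $\mathbb{R}[t]_d=\{f\in\mathbb{R}[t]:\deg f\le d\}\cong\mathbb{R}^{d+1}$. A linear matrix inequality (LMI) of size $s$ in variables $z$ is a condition $M(z)\succeq 0$ (positive semidefinite), where $M(z)$ is a real symmetric $s\times s$ matrix whose entries are affine-linear functions of $z$. For a set $C\subseteq\mathbb{R}^N$, a lifted semidefinite representation of size $\le s$ is a description $C=\{x\in\mathbb{R}^N:\exists\,y\in\mathbb{R}^m\text{ with }M_1(x,y)\succeq 0,\dots,M_\ell(x,y)\succeq 0\}$ with finite $m,\ell$,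 where each $M_i(x,y)\succeq0$ is an LMI in $(x,y)$ of size at most $s$. The semidefinite extension degree $\operatorname{sxdeg}(C)$ is the smallest $s$ for which such a representation exists ($\infty$ if there is none). *)

theory Defs
  imports
    "HOL-Computational_Algebra.Polynomial"
    "HOL-Library.Set_Algebras"
    "HOL-Library.Extended_Nat"
    "Jordan_Normal_Form.Matrix"
begin

section \<open>Sums of squares and sums of copositive fewnomials\<close>

definition sos_polys :: "nat \<Rightarrow> real poly set" where
  "sos_polys m = {p. degree p \<le> m \<and> (\<exists>qs. p = (\<Sum>q\<leftarrow>qs. q ^ 2))}"

definition poly_supp :: "real poly \<Rightarrow> nat set" where
  "poly_supp p = {i. coeff p i \<noteq> 0}"

definition CP :: "nat set \<Rightarrow> real poly set" where
  "CP J = {p. (\<forall>x\<ge>0. poly p x \<ge> 0) \<and> poly_supp p \<subseteq> J}"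

text \<open>The sum below is a Minkowski sum of sets, from \<^theory>\<open>HOL-Library.Set_Algebras\<close>.\<close>

definition SOCF :: "nat \<Rightarrow> nat \<Rightarrow> real poly set" where
  "SOCF k d = (\<Sum>J\<in>{J. J \<subseteq> {0..d} \<and> card J = k}. CP J)"

text \<open>The identification of the polynomials of degree at most \<open>d\<close> with real vectors of
  dimension \<open>d + 1\<close>.\<close>

definition coeff_vec :: "nat \<Rightarrow> real poly \<Rightarrow> real vec" where
  "coeff_vec d p = vec (d + 1) (coeff p)"

section \<open>Linear matrix inequalities and semidefinite extension degree\<close>

definition psd :: "real mat \<Rightarrow> bool" where
  "psd A \<longleftrightarrow> square_mat A \<and> transpose_mat A = A \<and>
     (\<forall>v\<in>carrier_vec (dim_row A). v \<bullet> (A *\<^sub>v v) \<ge> 0)"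

definition affine_form :: "nat \<Rightarrow> (real vec \<Rightarrow> real) \<Rightarrow> bool" where
  "affine_form n f \<longleftrightarrow> (\<exists>a\<in>carrier_vec n. \<exists>b. \<forall>z\<in>carrier_vec n. f z = a \<bullet> z + b)"

text \<open>\<open>M\<close> is the matrix of a linear matrix inequality of size \<open>s\<close> in \<open>n\<close> real variables.\<close>

definition lmi_matrix :: "nat \<Rightarrow> nat \<Rightarrow> (real vec \<Rightarrow> real mat) \<Rightarrow> bool" where
  "lmi_matrix n s M \<longleftrightarrow>
     (\<forall>z\<in>carrier_vec n. M z \<in> carrier_mat s s \<and> transpose_mat (M z) = M z) \<and>
     (\<forall>i<s. \<forall>j<s. affine_form n (\<lambda>z. M z $$ (i, j)))"

definition lifted_sd_rep :: "nat \<Rightarrow> real vec set \<Rightarrow> nat \<Rightarrow> bool" where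
  "lifted_sd_rep N C s \<longleftrightarrow>
     (\<exists>m Ms. (\<forall>M\<in>set Ms. \<exists>r\<le>s. lmi_matrix (N + m) r M) \<and>
       C = {x\<in>carrier_vec N. \<exists>y\<in>carrier_vec m. \<forall>M\<in>set Ms. psd (M (x @\<^sub>v y))})"

text \<open>The ambient dimension \<open>N\<close> is an argument, since it is not determined by \<open>C\<close> if \<open>C\<close> is empty.
  The infimum of the empty set is \<open>\<infinity>\<close>.\<close>

definition sxdeg :: "nat \<Rightarrow> real vec set \<Rightarrow> enat" where
  "sxdeg N C = (INF s\<in>{s. lifted_sd_rep N C s}. enat s)"

end

theory Submission
  imports Defs "Jordan_Normal_Form.Determinant" "HOL-Library.Ramsey"
begin

text \<open>For the equality of cones, let \<open>p\<close> be copositive with at most \<open>2k + 1\<close> terms, and let \<open>w\<close> be the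
  product of the factors \<open>X - x\<close> over its positive roots, with half their multiplicity. If \<open>p\<close> has as
  many positive roots as Descartes' rule allows, then \<open>p / w\<^sup>2\<close> has no sign changes, so that \<open>p\<close> is a
  nonnegative combination of the \<open>X\<^sup>j w\<^sup>2\<close>. Otherwise there is a nonzero multiple \<open>q\<close> of \<open>w\<^sup>2\<close> with
  smaller support, and moving from \<open>p\<close> along \<open>q\<close> in both directions until copositivity is lost writes
  \<open>p\<close> as a sum of polynomials with more positive roots or fewer terms.

  Gram matrices give a representation of size \<open>k + 1\<close>. For the lower bound, the polynomials
  \<open>\<Prod>t\<in>T. (X - t)\<^sup>2\<close> with \<open>card T = k\<close> show that every \<open>k\<close> evaluations at nonnegative points cut out a
  face on which no further evaluation vanishes. In a lift each evaluation has a kernel in every block,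
  and Ramsey's theorem yields a single block in which \<open>k + 1\<close> of these kernels are so independent that
  the size of the block exceeds \<open>k\<close>.\<close>

hide_const (open) module.smult

section \<open>Sign changes and positive roots\<close>

text \<open>More unknowns than equations: padding with zero rows gives a singular square matrix, and
  a kernel vector is carried to \<open>J\<close> along an enumeration.\<close>

lemma underdetermined_system:
  fixes f :: "nat \<Rightarrow> 'b \<Rightarrow> 'a :: field"
  assumes "finite J" and "r < card J"
  obtains a where "\<exists>j\<in>J. a j \<noteq> 0" and "\<And>i. i < r \<Longrightarrow> (\<Sum>j\<in>J. a j * f i j) = 0"
proof -
  define n where "n = card J"
  obtain e where e: "bij_betw e {..<n} J"
    using ex_bij_betw_nat_finite[OF assms(1)] by (auto simp: n_def atLeast0LessThan)
  define A where "A = mat n n (\<lambda>(i, j). if i < r then f i (e j) else 0)"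
  have A: "A \<in> carrier_mat n n" by (simp add: A_def)
  have "A = mat\<^sub>r n n (\<lambda>i. if i = r then 0\<^sub>v n else row A i)"
    using A by (intro eq_matI) (auto simp: A_def)
  moreover have "r < n" using assms by (simp add: n_def)
  ultimately have "det A = 0"
    using det_row_0[of r n "row A"] A by (metis (no_types, lifting) Pi_I carrier_matD(2) row_carrier)
  then obtain v where v: "v \<in> carrier_vec n" "v \<noteq> 0\<^sub>v n" "A *\<^sub>v v = 0\<^sub>v n"
    using det_0_iff_vec_prod_zero_field[OF A] by blast
  define a where "a = (\<lambda>j. v $ (inv_into {..<n} e j))"
  have ae: "a (e j) = v $ j" if "j < n" for j
    using that e by (simp add: a_def bij_betw_inv_into_left)
  show thesis
  proof
    obtain j where "j < n" "v $ j \<noteq> 0"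
      using v by (metis carrier_vecD dim_vec eq_vecI index_zero_vec(1) index_zero_vec(2))
    then show "\<exists>j\<in>J. a j \<noteq> 0"
      using ae e by (metis bij_betwE lessThan_iff)
    fix i assume i: "i < r"
    then have "i < n" using \<open>r < n\<close> by simp
    have "(\<Sum>j\<in>J. a j * f i j) = (\<Sum>j<n. a (e j) * f i (e j))"
      by (rule sum.reindex_bij_betw[OF e, symmetric])
    also have "\<dots> = (\<Sum>j<n. A $$ (i, j) * v $ j)"
      using \<open>i < n\<close> i by (intro sum.cong) (auto simp: ae A_def)
    also have "\<dots> = (A *\<^sub>v v) $ i"
      using \<open>i < n\<close> A v(1) by (auto simp: scalar_prod_def atLeast0LessThan intro!: sum.cong)
    also have "\<dots> = 0" using v(3) \<open>i < n\<close> by simp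
    finally show "(\<Sum>j\<in>J. a j * f i j) = 0" .
  qed
qed

text \<open>The remainders of the \<open>card J\<close> monomials modulo \<open>f\<close> lie in a
  space of dimension \<open>degree f\<close>, so they are linearly dependent, and the same
  combination of the monomials themselves is divisible by \<open>f\<close>.\<close>

lemma exists_multiple_with_support:
  fixes f :: "real poly"
  assumes "finite J" "f \<noteq> 0" "degree f < card J"
  obtains q where "q \<noteq> 0" "poly_supp q \<subseteq> J" "f dvd q"
proof -
  obtain a where a: "\<exists>j\<in>J. a j \<noteq> 0"
    "\<And>i. i < degree f \<Longrightarrow> (\<Sum>j\<in>J. a j * coeff (monom 1 j mod f) i) = 0"
    using underdetermined_system[OF assms(1,3), of "\<lambda>i j. coeff (monom 1 j mod f) i"] by blast
  define q where "q = (\<Sum>j\<in>J. monom (a j) j)"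
  have cq: "coeff q i = (if i \<in> J then a i else 0)" for i
    using assms(1) by (simp add: q_def coeff_sum)
  show thesis
  proof
    show "q \<noteq> 0" using a(1) cq by (metis coeff_0)
    show "poly_supp q \<subseteq> J" using cq by (auto simp: poly_supp_def)
    have "coeff (\<Sum>j\<in>J. smult (a j) (monom 1 j mod f)) i = 0" for i
    proof (cases "i < degree f")
      case True then show ?thesis by (simp add: coeff_sum a(2))
    next
      case False
      have "coeff (monom 1 j mod f) i = 0" for j
        using False assms(2) degree_mod_less[of f "monom 1 j"] by (auto intro: coeff_eq_0)
      then show ?thesis by (simp add: coeff_sum)
    qed
    then have 0: "(\<Sum>j\<in>J. smult (a j) (monom 1 j mod f)) = 0" by (simp add: poly_eq_iff)
    have "q = (\<Sum>j\<in>J. smult (a j) (monom 1 j))" by (simp add: q_def smult_monom)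
    also have "\<dots> = (\<Sum>j\<in>J. smult (a j) (monom 1 j - monom 1 j mod f))"
      using 0 by (simp add: smult_diff_right sum_subtractf)
    also have "f dvd \<dots>" by (intro dvd_sum dvd_smult) (simp add: dvd_minus_mod)
    finally show "f dvd q" .
  qed
qed

section \<open>Descartes' rule of signs, counting sign changes of the coefficients\<close>

definition alternates :: "real poly \<Rightarrow> nat \<Rightarrow> bool" where
  "alternates p m \<longleftrightarrow> (\<exists>i \<sigma>. (\<forall>j<m. i j < i (Suc j)) \<and> (\<forall>j\<le>m. \<sigma> * (-1) ^ j * coeff p (i j) > 0))"

lemma telescope_drop:
  fixes G :: "nat \<Rightarrow> real"
  assumes "G b < G a" "a \<le> b"
  obtains j where "a \<le> j" "j < b" "G (Suc j) < G j"
proof -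
  have "\<exists>j\<ge>a. j < b \<and> G (Suc j) < G j"
    using assms(2,1)
  proof (induction b rule: dec_induct)
    case base
    then show ?case by simp
  next
    case (step n)
    then show ?case by (meson less_Suc_eq not_le_imp_less order_le_less_trans)
  qed
  then show ?thesis using that by blast
qed

text \<open>The step behind Descartes' rule of signs: the coefficients of \<open>p = (X - x) g\<close>, weighted by
  powers of \<open>x\<close>, are the differences of those of \<open>g\<close>.\<close>

lemma alternates_mult_root:
  assumes "alternates g m" "x > 0"
  shows "alternates ([:-x, 1:] * g) (Suc m)"
proof -
  obtain i \<sigma> where i: "\<And>j. j < m \<Longrightarrow> i j < i (Suc j)"
    and \<sigma>: "\<And>j. j \<le> m \<Longrightarrow> \<sigma> * (-1) ^ j * coeff g (i j) > 0"
    using assms(1) by (auto simp: alternates_def)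
  let ?p = "[:-x, 1:] * g"
  define G where "G n = x ^ n * coeff (pCons 0 g) n" for n
  have G0: "G 0 = 0" by (simp add: G_def)
  have GS: "G (Suc n) = x ^ Suc n * coeff g n" for n by (simp add: G_def)
  have p: "x ^ n * coeff ?p n = G n - G (Suc n)" for n
    by (cases n) (simp_all add: G_def algebra_simps)
  define N where "N = Suc (Suc (max (degree g) (i m)))"
  have GN: "G N = 0" by (simp add: N_def GS coeff_eq_0)
  \<comment> \<open>Break points of \<open>G\<close>: it vanishes at the two outer ones,
    \<open>0\<close> and \<open>N\<close>, and takes alternating signs at the \<open>m + 1\<close>
    inner ones. Each of the \<open>m + 2\<close> gaps contributes one coefficient of
    \<open>?p\<close>.\<close>
  define n where "n l = (if l = 0 then 0 else if l \<le> Suc m then Suc (i (l - 1)) else N)" for l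
  have n_le: "n l \<le> n (Suc l)" if "l \<le> Suc m" for l
  proof (cases l)
    case 0 then show ?thesis by (simp add: n_def)
  next
    case (Suc l')
    then show ?thesis
      using i[of l'] that by (cases "l' = m") (auto simp: n_def N_def)
  qed
  have ex: "\<exists>j\<ge>n l. j < n (Suc l) \<and> - \<sigma> * (-1) ^ l * coeff ?p j > 0" if l: "l \<le> Suc m" for l
  proof -
    let ?t = "- \<sigma> * (-1) ^ l"
    have 1: "?t * G (n l) > 0" if pos: "l > 0"
    proof -
      obtain l' where l': "l = Suc l'" using pos by (cases l) auto
      then have "\<sigma> * (-1) ^ l' * coeff g (i l') > 0" using \<sigma> l by simp
      then have "x ^ Suc (i l') * (\<sigma> * (-1) ^ l' * coeff g (i l')) > 0"
        using assms(2) by (simp only: zero_less_mult_iff zero_less_power) simp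
      then show ?thesis using l l' by (simp add: n_def GS mult_ac)
    qed
    have 2: "?t * G (n (Suc l)) < 0" if "l \<le> m"
    proof -
      have "x ^ Suc (i l) * (\<sigma> * (-1) ^ l * coeff g (i l)) > 0"
        using assms(2) \<sigma>[OF that] by (simp only: zero_less_mult_iff zero_less_power) simp
      then show ?thesis using that by (simp add: n_def GS mult_ac)
    qed
    have 3: "?t * G (n l) = 0" if "l = 0" using that by (simp add: n_def G0)
    have 4: "?t * G (n (Suc l)) = 0" if "l = Suc m" using that by (simp add: n_def GN)
    have "?t * G (n (Suc l)) < ?t * G (n l)"
      using 1 2 3 4 l by (cases "l = 0"; cases "l = Suc m") force+
    then obtain j where j: "n l \<le> j" "j < n (Suc l)" "?t * G (Suc j) < ?t * G j"
      using telescope_drop[of "\<lambda>j. ?t * G j", OF _ n_le[OF l]] by blast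
    have "?t * (x ^ j * coeff ?p j) > 0" using j(3) unfolding p by (simp only: right_diff_distrib diff_gt_0_iff_gt)
    then have "x ^ j * (?t * coeff ?p j) > 0" by (simp only: mult.left_commute)
    then have "?t * coeff ?p j > 0"
      using assms(2) by (metis zero_less_mult_pos zero_less_power)
    then show ?thesis using j by blast
  qed
  then obtain f where f: "\<And>l. l \<le> Suc m \<Longrightarrow> n l \<le> f l \<and> f l < n (Suc l) \<and> - \<sigma> * (-1) ^ l * coeff ?p (f l) > 0"
    by metis
  have "f j < f (Suc j)" if "j < Suc m" for j
    using f[of j] f[of "Suc j"] that by simp
  then show ?thesis
    unfolding alternates_def using f by (intro exI[of _ f] exI[of _ "-\<sigma>"]) auto
qed

text \<open>The argument is a list rather than a set, so that a repeated entry records a multiple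
  root.\<close>

definition root_prod :: "real list \<Rightarrow> real poly" where
  "root_prod xs = (\<Prod>x\<leftarrow>xs. [:-x, 1:])"

lemma root_prod_simps [simp]:
  "root_prod [] = 1" "root_prod (x # xs) = [:-x, 1:] * root_prod xs"
  by (simp_all add: root_prod_def)

lemma root_prod_nonzero [simp]: "root_prod xs \<noteq> 0"
  by (induction xs) (auto simp del: mult_pCons_left)

lemma degree_root_prod [simp]: "degree (root_prod xs) = length xs"
  by (induction xs) (auto simp: degree_mult_eq simp del: mult_pCons_left)

lemma poly_root_prod_eq_0_iff: "poly (root_prod xs) y = 0 \<longleftrightarrow> y \<in> set xs"
  by (induction xs) auto

lemma alternates_root_prod:
  assumes "alternates h m" "\<forall>x\<in>set xs. x > 0"
  shows "alternates (root_prod xs ^ 2 * h) (m + 2 * length xs)"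
  using assms(2)
proof (induction xs)
  case Nil
  then show ?case using assms(1) by simp
next
  case (Cons x xs)
  have "root_prod (x # xs) ^ 2 * h = [:-x, 1:] * ([:-x, 1:] * (root_prod xs ^ 2 * h))"
    by (simp add: power2_eq_square mult_ac del: mult_pCons_left mult_pCons_right)
  moreover have "alternates \<dots> (Suc (Suc (m + 2 * length xs)))"
    using Cons by (intro alternates_mult_root) auto
  ultimately show ?case by simp
qed

text \<open>The \<open>m + 1\<close> alternating coefficients are nonzero at distinct exponents.
  Together with \<open>alternates_root_prod\<close> this bounds the number of positive roots by the
  number of terms.\<close>

lemma alternates_card_supp:
  assumes "alternates p m" "poly_supp p \<subseteq> J" "finite J"
  shows "m < card J"
proof -
  obtain i \<sigma> where i: "\<And>j. j < m \<Longrightarrow> i j < i (Suc j)"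
    and \<sigma>: "\<And>j. j \<le> m \<Longrightarrow> \<sigma> * (-1) ^ j * coeff p (i j) > (0::real)"
    using assms(1) by (auto simp: alternates_def)
  have mono: "i a < i b" if "a < b" "b \<le> m" for a b
    using that
  proof (induction b)
    case (Suc b)
    then have "i a \<le> i b" by (cases "a = b") auto
    also have "i b < i (Suc b)" using i Suc.prems by simp
    finally show ?case .
  qed simp
  have "inj_on i {..m}"
    by (intro linorder_inj_onI) (use mono in force)+
  moreover have "i ` {..m} \<subseteq> J"
    using \<sigma> assms(2) by (force simp: poly_supp_def)
  ultimately have "card {..m} \<le> card J"
    using assms(3) card_inj_on_le by blast
  then show ?thesis by simp
qed

lemma not_alternates_1:
  assumes "\<not> alternates h 1"
  shows "(\<forall>i. coeff h i \<ge> 0) \<or> (\<forall>i. coeff h i \<le> 0)"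
proof (rule ccontr)
  assume "\<not> ?thesis"
  then obtain a b where ab: "coeff h a < 0" "coeff h b > 0" by (auto simp: not_le)
  then have "a \<noteq> b" by auto
  then have "a < b \<or> b < a" by linarith
  then have "alternates h 1"
  proof
    assume "a < b"
    then show ?thesis unfolding alternates_def using ab
      by (intro exI[of _ "\<lambda>j. if j = 0 then a else b"] exI[of _ "-1"]) (auto simp: le_Suc_eq)
  next
    assume "b < a"
    then show ?thesis unfolding alternates_def using ab
      by (intro exI[of _ "\<lambda>j. if j = 0 then b else a"] exI[of _ "1"]) (auto simp: le_Suc_eq)
  qed
  then show False using assms by simp
qed

lemma alternates_0: "h \<noteq> 0 \<Longrightarrow> alternates h 0"
  unfolding alternates_def
  by (intro exI[of _ "\<lambda>_. degree h"] exI[of _ "lead_coeff h"])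
    (auto simp flip: power2_eq_square)

text \<open>A sign change of \<open>h\<close> together with the \<open>2 * length xs\<close>
  positive roots would force \<open>2 * length xs + 2\<close> terms. So the coefficients of
  \<open>h\<close> have one sign, and nonnegativity at a point beyond all roots decides
  which.\<close>

lemma poly_nonneg_imp_coeffs_nonneg:
  assumes xs: "\<forall>x\<in>set xs. x > 0"
    and J: "poly_supp (root_prod xs ^ 2 * h) \<subseteq> J" "finite J" "card J \<le> Suc (2 * length xs)"
    and nn: "\<forall>x\<ge>0. poly (root_prod xs ^ 2 * h) x \<ge> 0"
  shows "coeff h i \<ge> 0"
proof (rule ccontr)
  assume neg: "\<not> ?thesis"
  have "\<not> alternates h 1"
    using alternates_card_supp[OF alternates_root_prod[OF _ xs] J(1,2)] J(3) by fastforce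
  then have le: "coeff h j \<le> 0" for j using not_alternates_1 neg by blast
  have lt: "poly h x < 0" if "x > 0" for x
  proof -
    have "i \<le> degree h" using neg by (metis coeff_eq_0 not_le order_refl)
    then have "(\<Sum>j\<le>degree h. coeff h j * x ^ j) < (\<Sum>j\<le>degree h. 0)"
      using le that neg
      by (intro sum_strict_mono_ex1) (auto simp: mult_le_0_iff mult_less_0_iff intro!: bexI[of _ i])
    then show ?thesis by (simp add: poly_altdef)
  qed
  define y where "y = 1 + Max (insert 0 (set xs))"
  have y: "y > 0" "\<forall>x\<in>set xs. x < y"
    by (auto simp: y_def add_pos_nonneg Max_ge_iff intro!: le_imp_less_Suc)
       (metis List.finite_set Max.coboundedI add.commute finite_insert insertCI le_add_same_cancel2 less_add_one order_le_less_trans)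
  then have "poly (root_prod xs) y \<noteq> 0" by (auto simp: poly_root_prod_eq_0_iff)
  then have "poly (root_prod xs ^ 2 * h) y < 0"
    using lt[OF y(1)] by (simp add: mult_pos_neg)
  then show False using nn y(1) by (meson not_le order_less_imp_le)
qed

text \<open>At a simple root \<open>h\<close> would change sign, and \<open>w\<close> has only
  finitely many zeros, so \<open>w ^ 2 * h\<close> would be negative somewhere nearby.\<close>

lemma double_root_of_square_times:
  fixes w h :: "real poly"
  assumes "w \<noteq> 0" and nn: "\<forall>x\<ge>0. poly (w ^ 2 * h) x \<ge> 0" and "x > 0" "poly h x = 0"
  shows "[:-x, 1:] ^ 2 dvd h"
proof -
  obtain g where h: "h = [:-x, 1:] * g" using assms(4) by (auto simp: poly_eq_0_iff_dvd dvd_def)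
  have "poly g x = 0"
  proof (rule ccontr)
    assume g: "poly g x \<noteq> 0"
    have "isCont (poly g) x" by simp
    then have "(poly g \<longlongrightarrow> poly g x) (at x)" by (simp add: isCont_def)
    then have "\<forall>\<^sub>F y in at x. dist (poly g y) (poly g x) < \<bar>poly g x\<bar>"
      using g by (intro tendstoD) auto
    then obtain \<delta> where \<delta>: "\<delta> > 0" "\<And>y. y \<noteq> x \<Longrightarrow> dist y x < \<delta> \<Longrightarrow> dist (poly g y) (poly g x) < \<bar>poly g x\<bar>"
      unfolding eventually_at by auto
    \<comment> \<open>The side of \<open>x\<close> on which \<open>y - x\<close> and
      \<open>g\<close> have opposite signs, cut off at 0 to remain in the half-line.\<close>
    define I where "I = (if poly g x > 0 then {max 0 (x - \<delta>)<..<x} else {x<..<x + \<delta>})"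
    have "infinite I" using \<delta>(1) assms(3) by (auto simp: I_def)
    then obtain y where y: "y \<in> I" "poly w y \<noteq> 0"
      using poly_roots_finite[OF assms(1)] by (metis (mono_tags, lifting) finite_subset mem_Collect_eq subsetI)
    have "dist (poly g y) (poly g x) < \<bar>poly g x\<bar>"
      using y(1) by (intro \<delta>(2)) (auto simp: I_def dist_real_def split: if_splits)
    then have "(y - x) * poly g y < 0"
      using y(1) by (auto simp: I_def dist_real_def mult_less_0_iff split: if_splits)
    then have "poly h y < 0" by (simp add: h algebra_simps)
    then have "poly (w ^ 2 * h) y < 0" using y(2) by (simp add: mult_pos_neg)
    moreover have "y \<ge> 0" using y(1) assms(3) by (auto simp: I_def split: if_splits)
    ultimately show False using nn by force
  qed
  then have "[:-x, 1:] dvd g" by (simp add: poly_eq_0_iff_dvd)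
  then show ?thesis unfolding h power2_eq_square by (intro mult_dvd_mono) auto
qed

section \<open>Perturbation of polynomials that are positive on the half-line\<close>

lemma poly_lead_pos_eventually_pos:
  fixes p :: "real poly"
  assumes "lead_coeff p > 0"
  obtains X where "\<And>x. x \<ge> X \<Longrightarrow> poly p x > 0"
  using poly_pinfty_gt_lc[OF assms] assms by (meson order_less_le_trans)

text \<open>The quotient \<open>- g / h\<close> is bounded above on the half-line: near infinity by
  comparing degrees, on a compact interval by continuity. The reciprocal of a positive bound serves
  as \<open>\<epsilon>\<close>.\<close>

lemma dominate_positive_poly:
  fixes h g :: "real poly"
  assumes pos: "\<And>x. x \<ge> 0 \<Longrightarrow> poly h x > 0" and deg: "degree g \<le> degree h"
  obtains \<epsilon> where "\<epsilon> > 0" "\<And>x. x \<ge> 0 \<Longrightarrow> poly (h + smult \<epsilon> g) x \<ge> 0"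
proof -
  have "h \<noteq> 0" using pos[of 0] by auto
  have lc: "lead_coeff h > 0"
  proof (rule ccontr)
    assume "\<not> ?thesis"
    then have "lead_coeff (- h) > 0" using \<open>h \<noteq> 0\<close> by (simp add: linorder_not_less order_less_le)
    then obtain X where X: "\<And>x. x \<ge> X \<Longrightarrow> poly (- h) x > 0"
      by (rule poly_lead_pos_eventually_pos) blast
    show False using X[of "max X 0"] pos[of "max X 0"] by simp
  qed
  \<comment> \<open>Chosen so that the coefficient of \<open>smult c h + g\<close> at
    \<open>degree h\<close> is at least \<open>lead_coeff h\<close>.\<close>
  define c where "c = 1 + \<bar>coeff g (degree h)\<bar> / lead_coeff h"
  have c: "c > 0" using lc by (simp add: c_def add_pos_nonneg)
  have "c * lead_coeff h = lead_coeff h + \<bar>coeff g (degree h)\<bar>"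
    using lc by (simp add: c_def distrib_right del: leading_coeff_0_iff)
  then have "c * lead_coeff h + coeff g (degree h) > 0" using lc by linarith
  then have 1: "coeff (smult c h + g) (degree h) > 0" by simp
  have "degree (smult c h + g) \<le> degree h" using deg by (simp add: degree_add_le)
  then have "lead_coeff (smult c h + g) > 0" using 1
    by (metis coeff_eq_0 le_antisym less_irrefl not_le)
  then obtain X where X: "\<And>x. x \<ge> X \<Longrightarrow> poly (smult c h + g) x > 0"
    by (rule poly_lead_pos_eventually_pos) blast
  define Y where "Y = max X 0"
  have cont: "continuous_on {0..Y} (\<lambda>x. - poly g x / poly h x)"
    by (intro continuous_intros) (use pos in force)
  obtain z where z: "\<And>x. 0 \<le> x \<Longrightarrow> x \<le> Y \<Longrightarrow> - poly g x / poly h x \<le> z"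
    using continuous_attains_sup[OF compact_Icc _ cont] by (metis atLeastAtMost_iff atLeastatMost_empty_iff2 max.cobounded2 Y_def)
  define C where "C = max c z"
  have C: "C > 0" using c by (simp add: C_def)
  have main: "C * poly h x + poly g x \<ge> 0" if x: "x \<ge> 0" for x
  proof (cases "x \<le> Y")
    case True
    then have "- poly g x / poly h x \<le> C" using z[OF x] by (simp add: C_def)
    then show ?thesis using pos[OF x] by (simp add: field_simps)
  next
    case False
    then have "c * poly h x + poly g x > 0" using X[of x] by (simp add: Y_def)
    moreover have "c * poly h x \<le> C * poly h x" using pos[OF x] by (simp add: C_def)
    ultimately show ?thesis by linarith
  qed
  show thesis
  proof
    show "1 / C > 0" using C by simp
    show "poly (h + smult (1 / C) g) x \<ge> 0" if "x \<ge> 0" for x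
      using main[OF that] C by (simp add: field_simps)
  qed
qed

section \<open>Fewnomials as shifted sums of squares\<close>

lemma sos_polys_0 [simp]: "0 \<in> sos_polys m"
  by (auto simp: sos_polys_def intro!: exI[of _ "[]"])

lemma sos_polys_add: "p \<in> sos_polys m \<Longrightarrow> q \<in> sos_polys m \<Longrightarrow> p + q \<in> sos_polys m"
  unfolding sos_polys_def
  by (clarsimp simp: degree_add_le) (metis map_append sum_list_append)

lemma sos_polys_smult:
  assumes "p \<in> sos_polys m" "c \<ge> 0"
  shows "smult c p \<in> sos_polys m"
proof -
  obtain qs where qs: "p = (\<Sum>q\<leftarrow>qs. q ^ 2)" and "degree p \<le> m"
    using assms(1) by (auto simp: sos_polys_def)
  have "smult c p = (\<Sum>q\<leftarrow>map (smult (sqrt c)) qs. q ^ 2)"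
    unfolding qs using assms(2) by (induction qs) (simp_all add: smult_add_right smult_power)
  moreover have "degree (smult c p) \<le> m"
    using degree_smult_le \<open>degree p \<le> m\<close> by (rule order_trans)
  ultimately show ?thesis unfolding sos_polys_def by blast
qed

lemma sos_polys_square: "degree q \<le> k \<Longrightarrow> q ^ 2 \<in> sos_polys (2 * k)"
  unfolding sos_polys_def
  by (auto simp: degree_power_eq intro!: exI[of _ "[q]"] order_trans[OF degree_power_le])

definition shifted_sos :: "nat \<Rightarrow> nat \<Rightarrow> real poly set" where
  "shifted_sos k d = (\<Sum>i = 0..d - 2 * k. [:0, 1:] ^ i *o sos_polys (2 * k))"

lemma shifted_sos_iff:
  "p \<in> shifted_sos k d \<longleftrightarrow>
    (\<exists>\<sigma>. p = (\<Sum>i = 0..d - 2 * k. [:0, 1:] ^ i * \<sigma> i) \<and> (\<forall>i\<le>d - 2 * k. \<sigma> i \<in> sos_polys (2 * k)))"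
proof -
  have "p \<in> shifted_sos k d \<longleftrightarrow>
    (\<exists>s. p = sum s {0..d - 2 * k} \<and> (\<forall>i\<in>{0..d - 2 * k}. \<exists>\<sigma>\<in>sos_polys (2 * k). s i = [:0, 1:] ^ i * \<sigma>))"
    by (auto simp: shifted_sos_def set_sum_alt elt_set_times_def)
  also have "\<dots> \<longleftrightarrow> (\<exists>\<sigma>. p = (\<Sum>i = 0..d - 2 * k. [:0, 1:] ^ i * \<sigma> i) \<and> (\<forall>i\<le>d - 2 * k. \<sigma> i \<in> sos_polys (2 * k)))"
    (is "?L \<longleftrightarrow> ?R")
  proof
    assume ?L
    then obtain s \<sigma> where "p = sum s {0..d - 2 * k}"
      "\<forall>i\<in>{0..d - 2 * k}. \<sigma> i \<in> sos_polys (2 * k) \<and> s i = [:0, 1:] ^ i * \<sigma> i"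
      by metis
    then show ?R by (intro exI[of _ \<sigma>]) (auto intro!: sum.cong)
  next
    assume ?R
    then obtain \<sigma> where "p = (\<Sum>i = 0..d - 2 * k. [:0, 1:] ^ i * \<sigma> i)" "\<forall>i\<le>d - 2 * k. \<sigma> i \<in> sos_polys (2 * k)"
      by blast
    then show ?L by (intro exI[of _ "\<lambda>i. [:0, 1:] ^ i * \<sigma> i"]) auto
  qed
  finally show ?thesis .
qed

lemma shifted_sos_add:
  assumes "p \<in> shifted_sos k d" "q \<in> shifted_sos k d"
  shows "p + q \<in> shifted_sos k d"
proof -
  obtain \<sigma> \<tau> where
    "p = (\<Sum>i = 0..d - 2 * k. [:0, 1:] ^ i * \<sigma> i)" "\<forall>i\<le>d - 2 * k. \<sigma> i \<in> sos_polys (2 * k)"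
    "q = (\<Sum>i = 0..d - 2 * k. [:0, 1:] ^ i * \<tau> i)" "\<forall>i\<le>d - 2 * k. \<tau> i \<in> sos_polys (2 * k)"
    using assms unfolding shifted_sos_iff by blast
  then show ?thesis
    unfolding shifted_sos_iff
    by (intro exI[of _ "\<lambda>i. \<sigma> i + \<tau> i"]) (auto simp: sos_polys_add distrib_left sum.distrib)
qed

lemma shifted_sos_smult:
  assumes "p \<in> shifted_sos k d" "c \<ge> 0"
  shows "smult c p \<in> shifted_sos k d"
proof -
  obtain \<sigma> where \<sigma>: "p = (\<Sum>i = 0..d - 2 * k. [:0, 1:] ^ i * \<sigma> i)"
    "\<forall>i\<le>d - 2 * k. \<sigma> i \<in> sos_polys (2 * k)"
    using assms unfolding shifted_sos_iff by blast
  have "smult c p = (\<Sum>i = 0..d - 2 * k. smult c ([:0, 1:] ^ i * \<sigma> i))"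
    unfolding \<sigma>(1) by (simp add: poly_eq_iff coeff_sum sum_distrib_left)
  then have "smult c p = (\<Sum>i = 0..d - 2 * k. [:0, 1:] ^ i * smult c (\<sigma> i))"
    by (simp only: mult_smult_right)
  then show ?thesis
    unfolding shifted_sos_iff using \<sigma>(2) assms(2)
    by (intro exI[of _ "\<lambda>i. smult c (\<sigma> i)"]) (auto simp: sos_polys_smult)
qed

lemma shifted_sos_0 [simp]: "0 \<in> shifted_sos k d"
  unfolding shifted_sos_iff by (intro exI[of _ "\<lambda>_. 0"]) auto

lemma shifted_sos_sum: "(\<And>i. i \<in> I \<Longrightarrow> f i \<in> shifted_sos k d) \<Longrightarrow> sum f I \<in> shifted_sos k d"
  by (induction I rule: infinite_finite_induct) (auto simp: shifted_sos_add)

lemma shifted_sosI: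
  assumes "i \<le> d - 2 * k" "\<sigma> \<in> sos_polys (2 * k)"
  shows "[:0, 1:] ^ i * \<sigma> \<in> shifted_sos k d"
proof -
  have "(\<Sum>j = 0..d - 2 * k. [:0, 1:] ^ j * (if j = i then \<sigma> else 0)) =
      (\<Sum>j = 0..d - 2 * k. if j = i then [:0, 1:] ^ i * \<sigma> else 0)"
    by (intro sum.cong) auto
  also have "\<dots> = [:0, 1:] ^ i * \<sigma>" using assms(1) by simp
  finally show ?thesis
    unfolding shifted_sos_iff using assms(2)
    by (intro exI[of _ "\<lambda>j. if j = i then \<sigma> else 0"]) auto
qed

text \<open>If \<open>j > d - 2 k\<close>, an even power of \<open>X\<close> is absorbed into the square; the parity is adjusted
  with the shift \<open>d - 2 k - 1\<close>, which is where \<open>d > 2 k\<close> enters.\<close>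

lemma shifted_square_in_shifted_sos:
  assumes "d > 2 * k" "degree w \<le> k" "j + 2 * degree w \<le> d"
  shows "[:0, 1:] ^ j * w ^ 2 \<in> shifted_sos k d"
proof (cases "j \<le> d - 2 * k")
  case True
  then show ?thesis using assms by (intro shifted_sosI sos_polys_square)
next
  case False
  obtain i r where ir: "i \<le> d - 2 * k" "j = i + 2 * r" "i + 1 \<ge> d - 2 * k"
  proof (cases "even (j - (d - 2 * k))")
    case True
    then have "j = (d - 2 * k) + 2 * ((j - (d - 2 * k)) div 2)" using False by simp
    then show thesis by (intro that[of "d - 2 * k"]) auto
  next
    case odd: False
    then have "j = (d - 2 * k - 1) + 2 * ((j - (d - 2 * k) + 1) div 2)"
      using False assms(1) by (auto elim!: oddE)
    then show thesis using assms(1) by (intro that[of "d - 2 * k - 1"]) auto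
  qed
  have "degree ([:0, 1:] ^ r * w) \<le> r + degree w"
    by (rule order_trans[OF degree_mult_le]) (simp add: degree_power_eq)
  \<comment> \<open>Here \<open>2 * (r + degree w) = j - i + 2 * degree w \<le> d - i \<le> 2 * k +
    1\<close>, and by parity the left side is at most \<open>2 * k\<close>.\<close>
  also have "\<dots> \<le> k" using ir assms by linarith
  finally have "[:0, 1:] ^ i * ([:0, 1:] ^ r * w) ^ 2 \<in> shifted_sos k d"
    using ir by (intro shifted_sosI sos_polys_square)
  then show ?thesis by (simp add: ir(2) power_add power_mult power_mult_distrib mult_ac power_even_eq)
qed

section \<open>Copositive polynomials with prescribed support and their faces\<close>

lemma CP_iff: "p \<in> CP J \<longleftrightarrow> (\<forall>x\<ge>0. poly p x \<ge> 0) \<and> (\<forall>i. i \<notin> J \<longrightarrow> coeff p i = 0)"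
  by (auto simp: CP_def poly_supp_def)

text \<open>\<open>root_prod xs\<close> does not vanish at 0, so multiplying by its square leaves
  the order of vanishing at 0 unchanged.\<close>

lemma monom_dvd_of_root_prod_mult:
  assumes "\<forall>x\<in>set xs. x > 0" "\<And>i. i < a \<Longrightarrow> coeff (root_prod xs ^ 2 * h) i = 0"
  shows "monom 1 a dvd h"
proof (cases "h = 0")
  case False
  have "poly (root_prod xs ^ 2) 0 \<noteq> 0" using assms(1) by (auto simp: poly_root_prod_eq_0_iff)
  then have "order 0 (root_prod xs ^ 2) = 0" by (rule order_0I)
  then have "order 0 (root_prod xs ^ 2 * h) = order 0 h" using False by (simp add: order_mult)
  moreover have "monom 1 a dvd root_prod xs ^ 2 * h" using assms(2) by (simp add: monom_1_dvd_iff')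
  ultimately show ?thesis using False by (simp add: monom_1_dvd_iff)
qed simp

text \<open>After division by the power of \<open>X\<close> with exponent \<open>Min J\<close>, the
  nonzero end coefficients make the quotient of \<open>h\<close> positive also at 0 and of degree at
  least that of the quotient of \<open>g\<close>, so \<open>dominate_positive_poly\<close>
  applies.\<close>

lemma perturb_within_face:
  assumes xs: "\<forall>x\<in>set xs. x > 0" and J: "finite J" "J \<noteq> {}"
    and h: "root_prod xs ^ 2 * h \<in> CP J" "\<And>x. x > 0 \<Longrightarrow> poly h x > 0"
    and ends: "coeff (root_prod xs ^ 2 * h) (Min J) \<noteq> 0" "coeff (root_prod xs ^ 2 * h) (Max J) \<noteq> 0"
    and g: "poly_supp (root_prod xs ^ 2 * g) \<subseteq> J"
  obtains \<epsilon> where "\<epsilon> > 0" "root_prod xs ^ 2 * (h + smult \<epsilon> g) \<in> CP J"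
proof -
  let ?w = "root_prod xs ^ 2" and ?a = "Min J" and ?b = "Max J"
  have low: "i \<notin> J" if "i < ?a" for i using that J by (meson Min_le leD)
  have up: "i \<notin> J" if "i > ?b" for i using that J by (meson Max_ge leD)
  have gJ: "coeff (?w * g) i = 0" if "i \<notin> J" for i using g that by (auto simp: poly_supp_def)
  have hJ: "coeff (?w * h) i = 0" if "i \<notin> J" for i using h(1) that by (simp add: CP_iff)
  obtain h' where h': "h = monom 1 ?a * h'"
    using monom_dvd_of_root_prod_mult[OF xs, of ?a h] low hJ by (auto simp: dvd_def)
  obtain g' where g': "g = monom 1 ?a * g'"
    using monom_dvd_of_root_prod_mult[OF xs, of ?a g] low gJ by (auto simp: dvd_def)
  have "?w * h = monom 1 ?a * (?w * h')" unfolding h' by (rule mult.left_commute)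
  then have "coeff (?w * h) ?a = coeff (?w * h') 0" by (simp only: coeff_monom_mult) simp
  then have h'0: "poly h' 0 \<noteq> 0" using ends(1) by (auto simp: poly_0_coeff_0 coeff_mult_0)
  have h'pos: "poly h' x > 0" if "x > 0" for x
    using h(2)[OF that] that by (simp add: h' poly_monom zero_less_mult_iff)
  have "poly h' 0 > 0"
  proof (rule ccontr)
    assume "\<not> ?thesis"
    then have "poly h' 0 < 0" using h'0 by simp
    then obtain x where "0 < x" "poly h' x = 0" using poly_IVT_pos[of 0 1 h'] h'pos[of 1] by auto
    then show False using h'pos[of x] by simp
  qed
  then have pos: "poly h' x > 0" if "x \<ge> 0" for x using h'pos that by (cases "x = 0") auto
  have "degree g' \<le> degree h'"
  proof (cases "g' = 0")
    case False
    have "h' \<noteq> 0" using h'0 by auto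
    have "degree (?w * g) \<le> ?b" by (intro degree_le) (use gJ up in auto)
    also have "?b \<le> degree (?w * h)" using ends(2) by (rule le_degree)
    finally show ?thesis
      using False \<open>h' \<noteq> 0\<close> by (simp add: g' h' degree_mult_eq)
  qed simp
  then obtain \<epsilon> where \<epsilon>: "\<epsilon> > 0" "\<And>x. x \<ge> 0 \<Longrightarrow> poly (h' + smult \<epsilon> g') x \<ge> 0"
    using dominate_positive_poly[OF pos] by blast
  have "poly (?w * (h + smult \<epsilon> g)) x \<ge> 0" if "x \<ge> 0" for x
  proof -
    have "?w * (h + smult \<epsilon> g) = ?w * monom 1 ?a * (h' + smult \<epsilon> g')"
      by (simp add: h' g' algebra_simps)
    then show ?thesis using \<epsilon>(2)[OF that] that by (simp add: poly_monom)
  qed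
  moreover have "coeff (?w * (h + smult \<epsilon> g)) i = 0" if "i \<notin> J" for i
    using hJ[OF that] gJ[OF that] by (simp add: distrib_left)
  ultimately show thesis using \<epsilon>(1) by (intro that[of \<epsilon>]) (auto simp: CP_iff)
qed

text \<open>The induction measure stands for the dimension of the face of \<open>CP J\<close> containing the
  polynomial: \<open>card J\<close> minus the number of positive roots, counted with multiplicity.\<close>

lemma fewnomial_in_shifted_sos:
  assumes "d > 2 * k"
  shows "J \<subseteq> {0..d} \<Longrightarrow> card J \<le> 2 * k + 1 \<Longrightarrow> \<forall>x\<in>set xs. x > 0 \<Longrightarrow>
    root_prod xs ^ 2 * h \<in> CP J \<Longrightarrow> root_prod xs ^ 2 * h \<in> shifted_sos k d"
proof (induction "card J - 2 * length xs" arbitrary: J xs h rule: less_induct)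
  case less
  note J = less.prems(1,2) and xs = less.prems(3) and p = less.prems(4)
  let ?w = "root_prod xs ^ 2"
  have fin: "finite J" using J(1) finite_subset by blast
  \<comment> \<open>The second case attains Descartes' bound; the third leaves enough exponents for
    a further multiple of \<open>?w\<close> to perturb along.\<close>
  consider "h = 0" | "h \<noteq> 0" "card J \<le> Suc (2 * length xs)" | "card J \<ge> 2 * length xs + 2"
    by linarith
  then show ?case
  proof cases
    case 1
    then show ?thesis by simp
  next
    case 2
    have supp: "poly_supp (?w * h) \<subseteq> J" using p by (simp add: CP_def)
    have c: "coeff h i \<ge> 0" for i
      using p by (intro poly_nonneg_imp_coeffs_nonneg[OF xs supp fin 2(2)]) (simp add: CP_def)
    have "2 * length xs < card J"
      using alternates_card_supp[OF alternates_root_prod[OF alternates_0[OF 2(1)] xs] supp fin] by simp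
    then have len: "length xs \<le> k" using J(2) by simp
    have "degree (?w * h) \<le> d"
    proof (intro degree_le allI impI)
      fix i assume "d < i"
      then have "i \<notin> J" using J(1) by auto
      then show "coeff (?w * h) i = 0" using supp by (auto simp: poly_supp_def)
    qed
    then have deg: "degree h + 2 * length xs \<le> d"
      using 2(1) by (simp add: degree_mult_eq degree_power_eq)
    have "?w * h = (\<Sum>j\<le>degree h. smult (coeff h j) ([:0, 1:] ^ j * ?w))"
      by (subst (1) poly_as_sum_of_monoms[of h, symmetric])
        (simp add: sum_distrib_left monom_altdef mult_ac)
    also have "\<dots> \<in> shifted_sos k d"
      using assms len deg
      by (intro shifted_sos_sum shifted_sos_smult shifted_square_in_shifted_sos c) auto
    finally show ?thesis .
  next
    case 3
    then have Jne: "J \<noteq> {}" by auto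
    have drop: "?w * h' \<in> shifted_sos k d" if "m \<in> J" "?w * h' \<in> CP (J - {m})" for m h'
    proof (rule less.hyps[of "J - {m}" xs h'])
      have "card (J - {m}) = card J - 1" using that(1) fin by simp
      then show "card (J - {m}) - 2 * length xs < card J - 2 * length xs" "card (J - {m}) \<le> 2 * k + 1"
        using 3 J(2) by auto
    qed (use J xs that in auto)
    \<comment> \<open>Outside \<open>shifted_sos k d\<close> neither end coefficient can vanish,
      since \<open>J\<close> would shrink, and \<open>h'\<close> has no positive root, since such a
      root is double and would extend \<open>xs\<close>. Either would lower the induction
      measure.\<close>
    have generic: "(\<forall>x>0. poly h' x > 0) \<and> coeff (?w * h') (Min J) \<noteq> 0 \<and> coeff (?w * h') (Max J) \<noteq> 0"
      if CP: "?w * h' \<in> CP J" and not: "?w * h' \<notin> shifted_sos k d" for h'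
    proof (intro conjI allI impI notI)
      assume "coeff (?w * h') (Min J) = 0"
      then show False using drop[of "Min J"] CP not fin Jne by (auto simp: CP_iff)
    next
      assume "coeff (?w * h') (Max J) = 0"
      then show False using drop[of "Max J"] CP not fin Jne by (auto simp: CP_iff)
    next
      fix x :: real assume x: "x > 0"
      have root: "poly h' y \<noteq> 0" if y: "y > 0" for y
      proof
        assume "poly h' y = 0"
        then have "[:-y, 1:] ^ 2 dvd h'"
          using CP y by (intro double_root_of_square_times[of "root_prod xs"]) (auto simp: CP_def)
        then obtain h2 where "h' = [:-y, 1:] ^ 2 * h2" by (auto simp: dvd_def)
        then have eq: "?w * h' = root_prod (y # xs) ^ 2 * h2"
          by (simp only: root_prod_simps power_mult_distrib mult_ac)
        have "root_prod (y # xs) ^ 2 * h2 \<in> shifted_sos k d"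
          using 3 J xs y CP unfolding eq by (intro less.hyps[of J "y # xs" h2]) auto
        then show False using not eq by simp
      qed
      show "poly h' x > 0"
      proof (rule ccontr)
        assume "\<not> ?thesis"
        then have neg: "poly h' x < 0" using root[OF x] by simp
        have "isCont (poly h') x" by simp
        then have "\<forall>\<^sub>F y in at x. poly h' y < 0"
          using neg by (auto simp: isCont_def intro: order_tendstoD)
        then obtain \<delta> where \<delta>: "\<delta> > 0" "\<And>y. y \<noteq> x \<Longrightarrow> dist y x < \<delta> \<Longrightarrow> poly h' y < 0"
          unfolding eventually_at by auto
        have "infinite {x<..<x + \<delta>}" using \<delta>(1) by simp
        then obtain y where y: "y \<in> {x<..<x + \<delta>}" "y \<notin> set xs"
          by (metis List.finite_set finite_subset subsetI)
        have "poly h' y < 0" using y(1) by (intro \<delta>(2)) (auto simp: dist_real_def)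
        then have "poly (?w * h') y < 0" using y(2) by (simp add: mult_pos_neg poly_root_prod_eq_0_iff)
        moreover have "y \<ge> 0" using x y(1) by simp
        ultimately show False using CP by (auto simp: CP_def not_le[symmetric])
      qed
    qed
    show ?thesis
    proof (rule ccontr)
      assume not: "?w * h \<notin> shifted_sos k d"
      \<comment> \<open>\<open>Max J\<close> is set aside so that a copositive direction
        \<open>q\<close> has smaller support and falls under \<open>drop\<close>. The remaining
        \<open>card J - 1\<close> exponents still outnumber \<open>degree ?w\<close>.\<close>
      have "card (J - {Max J}) = card J - 1" using fin Jne by simp
      then have "degree ?w < card (J - {Max J})" using 3 by (simp add: degree_power_eq)
      then obtain q where q: "q \<noteq> 0" "poly_supp q \<subseteq> J - {Max J}" "?w dvd q"
        using exists_multiple_with_support[of "J - {Max J}" ?w] fin by auto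
      then obtain g where g: "q = ?w * g" by (auto simp: dvd_def)
      \<comment> \<open>Follow \<open>?w * (h + smult s g)\<close> as \<open>s\<close> grows. If it
        stays in \<open>CP J\<close> forever, the direction is copositive. Otherwise the last
        copositive point cannot be generic, as it could be moved further, so it lies in
        \<open>shifted_sos k d\<close>.\<close>
      have ray: "?w * g \<in> CP (J - {Max J}) \<or> (\<exists>s>0. ?w * (h + smult s g) \<in> shifted_sos k d)"
        if supp: "poly_supp (?w * g) \<subseteq> J - {Max J}" for g
      proof -
        define S where "S = {s. s \<ge> 0 \<and> ?w * (h + smult s g) \<in> CP J}"
        have gJ: "coeff (?w * g) i = 0" if "i \<notin> J" for i using supp that by (auto simp: poly_supp_def)
        have hJ: "coeff (?w * h) i = 0" if "i \<notin> J" for i using p that by (simp add: CP_iff)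
        have S: "S = {0..} \<inter> (\<Inter>x\<in>{0..}. {s. 0 \<le> poly (?w * h) x + s * poly (?w * g) x})"
          using gJ hJ by (auto simp: S_def CP_iff algebra_simps)
        have step: "\<exists>e>0. s + e \<in> S" if s: "s \<in> S" "?w * (h + smult s g) \<notin> shifted_sos k d" for s
        proof -
          have CPs: "?w * (h + smult s g) \<in> CP J" using s(1) by (simp add: S_def)
          have "poly_supp (?w * g) \<subseteq> J" using supp by blast
          then obtain e where e: "e > 0" "?w * (h + smult s g + smult e g) \<in> CP J"
            using generic[OF CPs s(2)] perturb_within_face[OF xs fin Jne CPs] by metis
          moreover have "h + smult s g + smult e g = h + smult (s + e) g"
            by (simp only: smult_add_left add.assoc)
          ultimately show ?thesis using s(1) unfolding S_def
            by (metis (mono_tags, lifting) add_nonneg_nonneg mem_Collect_eq order_less_imp_le)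
        qed
        have "0 \<in> S" using p by (simp add: S_def)
        show ?thesis
        proof (cases "bdd_above S")
          case True
          have upper: "s \<le> Sup S" if "s \<in> S" for s using True that by (rule cSup_upper[rotated])
          \<comment> \<open>Copositivity is a closed condition: \<open>S\<close> is cut out by weak
            affine inequalities in \<open>s\<close>, so it contains its supremum.\<close>
          have Sup: "Sup S \<in> S"
          proof -
            have "0 \<le> poly (?w * h) x + Sup S * poly (?w * g) x" if x: "x \<ge> 0" for x
            proof (cases "poly (?w * g) x \<ge> 0")
              case True
              have "poly (?w * h) x \<ge> 0" using p x unfolding CP_iff by blast
              then show ?thesis using True upper[OF \<open>0 \<in> S\<close>] by (metis add_nonneg_nonneg mult_nonneg_nonneg)
            next
              case False
              then have neg: "poly (?w * g) x < 0" by simp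
              have "s \<le> - poly (?w * h) x / poly (?w * g) x" if "s \<in> S" for s
              proof -
                have "0 \<le> poly (?w * h) x + s * poly (?w * g) x" using that x unfolding S by blast
                then show ?thesis using neg by (simp only: neg_le_divide_eq)
              qed
              then have "Sup S \<le> - poly (?w * h) x / poly (?w * g) x"
                using \<open>0 \<in> S\<close> by (intro cSup_least) auto
              then have "- poly (?w * h) x \<le> Sup S * poly (?w * g) x"
                using neg by (simp only: neg_le_divide_eq)
              then show ?thesis by linarith
            qed
            then show ?thesis using upper[OF \<open>0 \<in> S\<close>] unfolding S by auto
          qed
          obtain e where "e > 0" "0 + e \<in> S" using step[OF \<open>0 \<in> S\<close>] not by auto
          then have "Sup S > 0" using upper[of e] by simp
          moreover have "?w * (h + smult (Sup S) g) \<in> shifted_sos k d"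
          proof (rule ccontr)
            assume "\<not> ?thesis"
            then obtain e where "e > 0" "Sup S + e \<in> S" using step[OF Sup] by blast
            then show False using upper[of "Sup S + e"] by simp
          qed
          ultimately show ?thesis by blast
        next
          case False
          have "poly (?w * g) x \<ge> 0" if x: "x \<ge> 0" for x
          proof (rule ccontr)
            assume "\<not> ?thesis"
            then have neg: "poly (?w * g) x < 0" by simp
            obtain s where s: "s \<in> S" "s > - poly (?w * h) x / poly (?w * g) x"
              using False by (auto simp: bdd_above_def not_le)
            then have "0 \<le> poly (?w * h) x + s * poly (?w * g) x" using x by (auto simp: S)
            moreover have "s * poly (?w * g) x < - poly (?w * h) x"
              using s(2) neg by (simp only: neg_divide_less_eq)
            ultimately show False by linarith
          qed
          then show ?thesis using supp by (simp add: CP_def)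
        qed
      qed
      have K1: "?w * g \<in> CP (J - {Max J}) \<or> (\<exists>s>0. ?w * (h + smult s g) \<in> shifted_sos k d)"
        using q(2) g by (intro ray) auto
      have K2: "?w * (- g) \<in> CP (J - {Max J}) \<or> (\<exists>s>0. ?w * (h + smult s (- g)) \<in> shifted_sos k d)"
        using q(2) g by (intro ray) (auto simp: poly_supp_def)
      \<comment> \<open>One copositive direction and one ray that ends: \<open>?w * h\<close> is the
        end point of the ray plus a multiple of the direction.\<close>
      have combine: False
        if "?w * g \<in> shifted_sos k d" "s > 0" "?w * (h + smult s (- g)) \<in> shifted_sos k d" for g s
      proof -
        have "?w * h = ?w * (h + smult s (- g)) + smult s (?w * g)" by (simp add: algebra_simps)
        then show False using not that shifted_sos_add shifted_sos_smult
          by (metis order_less_imp_le)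
      qed
      \<comment> \<open>Otherwise \<open>q\<close> would vanish on the whole half-line.\<close>
      have "\<not> (?w * g \<in> CP (J - {Max J}) \<and> ?w * (- g) \<in> CP (J - {Max J}))"
      proof
        assume *: "?w * g \<in> CP (J - {Max J}) \<and> ?w * (- g) \<in> CP (J - {Max J})"
        have "poly q x = 0" if "x \<ge> 0" for x
        proof (rule antisym)
          show "poly q x \<ge> 0" using * that by (simp add: CP_def g)
          show "poly q x \<le> 0" using * that by (simp add: CP_def g)
        qed
        then have "{0..} \<subseteq> {x. poly q x = 0}" by auto
        then show False using poly_roots_finite[OF q(1)] infinite_Ici finite_subset by blast
      qed
      then consider s where "?w * g \<in> shifted_sos k d" "s > 0" "?w * (h + smult s (- g)) \<in> shifted_sos k d"
        | s where "?w * (- g) \<in> shifted_sos k d" "s > 0" "?w * (h + smult s (- (- g))) \<in> shifted_sos k d"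
        | s t where "s > 0" "t > 0" "?w * (h + smult s g) \<in> shifted_sos k d" "?w * (h + smult t (- g)) \<in> shifted_sos k d"
        using K1 K2 drop[of "Max J" g] drop[of "Max J" "- g"] fin Jne by auto
      then show False
      proof cases
        case (3 s t)
        \<comment> \<open>Both rays end: \<open>?w * h\<close> lies on the segment between the two
          end points, with weights proportional to \<open>t\<close> and \<open>s\<close>.\<close>
        have eq: "smult (s + t) (?w * h) = smult t (?w * (h + smult s g)) + smult s (?w * (h + smult t (- g)))"
          by (simp add: poly_eq_poly_eq_iff[symmetric] fun_eq_iff algebra_simps)
        have "smult (s + t) (?w * h) \<in> shifted_sos k d"
          unfolding eq using 3 by (intro shifted_sos_add shifted_sos_smult) auto
        then have "smult (1 / (s + t)) (smult (s + t) (?w * h)) \<in> shifted_sos k d"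
          by (rule shifted_sos_smult) (use 3(1,2) in auto)
        moreover have "s + t \<noteq> 0" using 3(1,2) by simp
        ultimately show False using not by (simp only: smult_smult) simp
      qed (use combine in blast)+
    qed
  qed
qed

lemma CP_subset_shifted_sos:
  assumes "d > 2 * k" "J \<subseteq> {0..d}" "card J \<le> 2 * k + 1"
  shows "CP J \<subseteq> shifted_sos k d"
  using fewnomial_in_shifted_sos[OF assms, of "[]"] by auto

section \<open>Comparison of the two cones\<close>

lemma SOCF_iff:
  "p \<in> SOCF n d \<longleftrightarrow> (\<exists>f. p = (\<Sum>J | J \<subseteq> {0..d} \<and> card J = n. f J) \<and> (\<forall>J. J \<subseteq> {0..d} \<and> card J = n \<longrightarrow> f J \<in> CP J))"
proof -
  have "finite {J. J \<subseteq> {0..d} \<and> card J = n}" by simp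
  then show ?thesis unfolding SOCF_def by (subst set_sum_alt) auto
qed

lemma CP_0 [simp]: "0 \<in> CP J"
  by (simp add: CP_iff)

lemma CP_add: "p \<in> CP J \<Longrightarrow> q \<in> CP J \<Longrightarrow> p + q \<in> CP J"
  by (simp add: CP_iff)

lemma SOCF_0 [simp]: "0 \<in> SOCF n d"
  unfolding SOCF_iff by (intro exI[of _ "\<lambda>_. 0"]) auto

lemma SOCF_add:
  assumes "p \<in> SOCF n d" "q \<in> SOCF n d"
  shows "p + q \<in> SOCF n d"
proof -
  let ?I = "{J. J \<subseteq> {0..d} \<and> card J = n}"
  obtain f g where "p = sum f ?I" "q = sum g ?I"
    "\<forall>J. J \<subseteq> {0..d} \<and> card J = n \<longrightarrow> f J \<in> CP J" "\<forall>J. J \<subseteq> {0..d} \<and> card J = n \<longrightarrow> g J \<in> CP J"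
    using assms unfolding SOCF_iff by blast
  then show ?thesis
    unfolding SOCF_iff by (intro exI[of _ "\<lambda>J. f J + g J"]) (auto simp: sum.distrib CP_add)
qed

lemma SOCF_sum: "(\<And>i. i \<in> I \<Longrightarrow> f i \<in> SOCF n d) \<Longrightarrow> sum f I \<in> SOCF n d"
  by (induction I rule: infinite_finite_induct) (auto simp: SOCF_add)

lemma CP_subset_SOCF:
  assumes "J \<subseteq> {0..d}" "card J = n"
  shows "CP J \<subseteq> SOCF n d"
proof
  fix p assume "p \<in> CP J"
  moreover have "(\<Sum>J' | J' \<subseteq> {0..d} \<and> card J' = n. if J' = J then p else 0) = p"
    using assms by simp
  ultimately show "p \<in> SOCF n d"
    unfolding SOCF_iff by (intro exI[of _ "\<lambda>J'. if J' = J then p else 0"]) auto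
qed

text \<open>The support lies in the window \<open>{i..i + 2 * k}\<close> of exactly
  \<open>2 * k + 1\<close> exponents.\<close>

lemma shifted_nonneg_in_SOCF:
  assumes "i + 2 * k \<le> d" "degree \<sigma> \<le> 2 * k" "\<And>x. poly \<sigma> x \<ge> 0"
  shows "[:0, 1:] ^ i * \<sigma> \<in> SOCF (2 * k + 1) d"
proof -
  have "[:0, 1:] ^ i * \<sigma> \<in> CP {i..i + 2 * k}"
    using assms(2,3) by (auto simp: CP_iff coeff_monom_mult coeff_eq_0 poly_monom simp flip: monom_altdef[of 1, simplified])
  then show ?thesis
    using CP_subset_SOCF[of "{i..i + 2 * k}" d "2 * k + 1"] assms(1) by auto
qed

lemma SOCF_eq_shifted_sos:
  assumes "d > 2 * k"
  shows "SOCF (2 * k + 1) d = shifted_sos k d"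
proof
  show "SOCF (2 * k + 1) d \<subseteq> shifted_sos k d"
  proof
    fix p assume "p \<in> SOCF (2 * k + 1) d"
    then obtain f where p: "p = (\<Sum>J | J \<subseteq> {0..d} \<and> card J = 2 * k + 1. f J)"
      and f: "\<forall>J. J \<subseteq> {0..d} \<and> card J = 2 * k + 1 \<longrightarrow> f J \<in> CP J"
      unfolding SOCF_iff by blast
    show "p \<in> shifted_sos k d"
      unfolding p
    proof (rule shifted_sos_sum)
      fix J assume "J \<in> {J. J \<subseteq> {0..d} \<and> card J = 2 * k + 1}"
      then show "f J \<in> shifted_sos k d" using f CP_subset_shifted_sos[OF assms, of J] by auto
    qed
  qed
  have nn: "poly \<sigma> x \<ge> 0" if "\<sigma> \<in> sos_polys m" for \<sigma> m x
  proof -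
    have "\<exists>qs. \<sigma> = (\<Sum>q\<leftarrow>qs. q ^ 2)" using that by (simp add: sos_polys_def)
    moreover have "poly (\<Sum>q\<leftarrow>qs. q ^ 2) x \<ge> 0" for qs by (induction qs) auto
    ultimately show ?thesis by metis
  qed
  show "shifted_sos k d \<subseteq> SOCF (2 * k + 1) d"
  proof
    fix p assume "p \<in> shifted_sos k d"
    then obtain \<sigma> where p: "p = (\<Sum>i = 0..d - 2 * k. [:0, 1:] ^ i * \<sigma> i)"
      and \<sigma>: "\<forall>i\<le>d - 2 * k. \<sigma> i \<in> sos_polys (2 * k)"
      unfolding shifted_sos_iff by blast
    show "p \<in> SOCF (2 * k + 1) d"
      unfolding p
    proof (intro SOCF_sum shifted_nonneg_in_SOCF)
      fix i assume i: "i \<in> {0..d - 2 * k}"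
      then show "i + 2 * k \<le> d" using assms by auto
      show "degree (\<sigma> i) \<le> 2 * k" using \<sigma> i by (auto simp: sos_polys_def)
      show "poly (\<sigma> i) x \<ge> 0" for x using \<sigma> i by (intro nn[of _ "2 * k"]) auto
    qed
  qed
qed

section \<open>Forms and spectrahedra\<close>

text \<open>Matrices are functions on indices here, of which only those below \<open>n\<close>
  count, so that an induction on the dimension can drop the last coordinate without
  resizing.\<close>

definition qform :: "nat \<Rightarrow> (nat \<Rightarrow> nat \<Rightarrow> real) \<Rightarrow> (nat \<Rightarrow> real) \<Rightarrow> real" where
  "qform n A v = (\<Sum>i<n. \<Sum>j<n. v i * A i j * v j)"

definition psd_form :: "nat \<Rightarrow> (nat \<Rightarrow> nat \<Rightarrow> real) \<Rightarrow> bool" where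
  "psd_form n A \<longleftrightarrow> (\<forall>i<n. \<forall>j<n. A i j = A j i) \<and> (\<forall>v. qform n A v \<ge> 0)"

lemma qform_cong:
  "(\<And>i. i < n \<Longrightarrow> v i = w i) \<Longrightarrow> (\<And>i j. i < n \<Longrightarrow> j < n \<Longrightarrow> A i j = B i j) \<Longrightarrow> qform n A v = qform n B w"
  unfolding qform_def by (intro sum.cong) auto

lemma qform_scale: "qform n A (\<lambda>i. c * v i) = c ^ 2 * qform n A v"
  by (simp add: qform_def sum_distrib_left power2_eq_square mult_ac)

lemma qform_parallelogram:
  "qform n A (\<lambda>i. u i + v i) + qform n A (\<lambda>i. u i - v i) = 2 * qform n A u + 2 * qform n A v"
  by (simp add: qform_def sum_distrib_left algebra_simps flip: sum.distrib)

text \<open>For a positive semidefinite form the parallelogram law makes the zero set closed under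
  addition; it is the kernel of the matrix.\<close>

lemma qform_add_eq_0:
  assumes "psd_form n A" "qform n A u = 0" "qform n A v = 0"
  shows "qform n A (\<lambda>i. u i + v i) = 0"
proof -
  have "qform n A (\<lambda>i. u i + v i) \<ge> 0" "qform n A (\<lambda>i. u i - v i) \<ge> 0"
    using assms(1) by (auto simp: psd_form_def)
  then show ?thesis using qform_parallelogram[of n A u v] assms(2,3) by linarith
qed

lemma qform_sum_eq_0:
  assumes "psd_form n A" "\<And>l. l \<in> I \<Longrightarrow> qform n A (f l) = 0"
  shows "qform n A (\<lambda>i. \<Sum>l\<in>I. c l * f l i) = 0"
  using assms(2)
proof (induction I rule: infinite_finite_induct)
  case (insert l I)
  have "qform n A (\<lambda>i. c l * f l i + (\<Sum>l\<in>I. c l * f l i)) = 0"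
    using insert by (intro qform_add_eq_0[OF assms(1)]) (auto simp: qform_scale)
  then show ?case using insert by simp
qed (simp_all add: qform_def)

lemma qform_Suc:
  assumes "\<And>i. i < n \<Longrightarrow> A i n = A n i"
  shows "qform (Suc n) A v = qform n A v + 2 * v n * (\<Sum>i<n. A i n * v i) + A n n * v n ^ 2"
proof -
  have "(\<Sum>j<n. v n * A n j * v j) = v n * (\<Sum>i<n. A i n * v i)"
    using assms by (simp add: sum_distrib_left mult_ac)
  moreover have "(\<Sum>i<n. v i * A i n * v n) = v n * (\<Sum>i<n. A i n * v i)"
    by (simp add: sum_distrib_left mult_ac)
  ultimately show ?thesis
    by (simp add: qform_def sum.distrib power2_eq_square)
qed

text \<open>This is a form in one more variable, with last column \<open>m\<close> and last diagonal
  entry \<open>\<gamma>\<close>, after substituting \<open>- (\<Sum>i<n. l i * v i)\<close> for the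
  last coordinate.\<close>

lemma qform_rank_update:
  "qform n (\<lambda>i j. A i j - (l i * m j + l j * m i) + l i * l j * \<gamma>) v =
    qform n A v - 2 * (\<Sum>i<n. l i * v i) * (\<Sum>i<n. m i * v i) + \<gamma> * (\<Sum>i<n. l i * v i) ^ 2"
proof -
  have 1: "(\<Sum>i<n. \<Sum>j<n. v i * (f i * g j) * v j) = (\<Sum>i<n. f i * v i) * (\<Sum>i<n. g i * v i)" for f g
    by (simp add: sum_product mult_ac)
  have 2: "(\<Sum>i<n. \<Sum>j<n. v i * (f i * g j * \<gamma>) * v j) = \<gamma> * ((\<Sum>i<n. f i * v i) * (\<Sum>i<n. g i * v i))" for f g
    unfolding 1[symmetric] by (simp add: sum_distrib_left mult_ac)
  have "qform n (\<lambda>i j. A i j - (l i * m j + l j * m i) + l i * l j * \<gamma>) v =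
    qform n A v - ((\<Sum>i<n. \<Sum>j<n. v i * (l i * m j) * v j) + (\<Sum>i<n. \<Sum>j<n. v i * (m i * l j) * v j))
      + (\<Sum>i<n. \<Sum>j<n. v i * (l i * l j * \<gamma>) * v j)"
    by (simp add: qform_def algebra_simps sum.distrib sum_subtractf)
  then show ?thesis unfolding 1 2 by (simp add: power2_eq_square)
qed

lemma affine_nonneg_imp_slope_0:
  fixes a b :: real
  assumes "\<And>t. a + b * t \<ge> 0"
  shows "b = 0"
proof (rule ccontr)
  assume "b \<noteq> 0"
  then show False using assms[of "- (a + 1) / b"] by simp
qed

text \<open>By induction on the dimension: eliminate the last coordinate by a Schur complement with
  respect to \<open>A\<close>, which turns both forms into forms on the \<open>A\<close>-orthogonal complement.\<close>

lemma psd_form_dominated: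
  assumes "psd_form n A" "psd_form n B" "\<And>v. qform n A v = 0 \<Longrightarrow> qform n B v = 0"
  shows "\<exists>c. \<forall>v. qform n B v \<le> c * qform n A v"
  using assms
proof (induction n arbitrary: A B)
  case 0
  then show ?case by (simp add: qform_def)
next
  case (Suc n)
  have symA: "A i j = A j i" and symB: "B i j = B j i" if "i < Suc n" "j < Suc n" for i j
    using Suc.prems(1,2) that by (auto simp: psd_form_def)
  have posA: "qform (Suc n) A v \<ge> 0" and posB: "qform (Suc n) B v \<ge> 0" for v
    using Suc.prems(1,2) by (auto simp: psd_form_def)
  note expA = qform_Suc[of n A, OF symA] and expB = qform_Suc[of n B, OF symB]
  have last: "qform (Suc n) X (v(n := t)) = qform n X v + 2 * t * (\<Sum>i<n. X i n * v i) + X n n * t ^ 2"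
    if "X = A \<or> X = B" for X v t
  proof -
    have "qform n X (v(n := t)) = qform n X v" by (intro qform_cong) auto
    then show ?thesis using that expA[of "v(n := t)"] expB[of "v(n := t)"] by auto
  qed
  define e :: "nat \<Rightarrow> real" where "e = (\<lambda>_. 0)(n := 1)"
  have eA: "qform (Suc n) A e = A n n" and eB: "qform (Suc n) B e = B n n"
    unfolding e_def by (simp_all add: last) (simp_all add: qform_def)
  show ?case
  proof (cases "A n n = 0")
    case True
    then have "B n n = 0" using Suc.prems(3) eA eB by metis
    \<comment> \<open>With zero last diagonal entry the form is affine in the last coordinate and
      nonnegative, so that coordinate does not enter.\<close>
    have drop: "qform (Suc n) X v = qform n X v" if X: "X = A \<or> X = B" for X v
    proof -
      have "X n n = 0" using X True \<open>B n n = 0\<close> by auto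
      then have eq: "qform (Suc n) X (v(n := t)) = qform n X v + (2 * (\<Sum>i<n. X i n * v i)) * t" for t
        using last[OF X] by simp
      have "2 * (\<Sum>i<n. X i n * v i) = 0"
        using X posA posB eq by (intro affine_nonneg_imp_slope_0[of "qform n X v"]) metis
      then show ?thesis using eq[of "v n"] by simp
    qed
    have dA: "qform (Suc n) A = qform n A" and dB: "qform (Suc n) B = qform n B"
      using drop by auto
    show ?thesis
      unfolding dA dB
      using Suc.prems unfolding dA dB psd_form_def by (intro Suc.IH) (auto simp: psd_form_def)
  next
    case False
    define \<alpha> where "\<alpha> = A n n"
    have \<alpha>: "\<alpha> > 0" using False posA[of e] eA by (simp add: \<alpha>_def)
    \<comment> \<open>With this \<open>l\<close>, the vector \<open>v' v\<close> differs from
      \<open>v\<close> only in the last coordinate and is orthogonal to \<open>e\<close> with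
      respect to \<open>A\<close>; \<open>red X\<close> is the form \<open>X\<close> on such
      vectors.\<close>
    define l where "l i = A i n / \<alpha>" for i
    define red where "red X i j = X i j - (l i * X j n + l j * X i n) + l i * l j * X n n" for X :: "nat \<Rightarrow> nat \<Rightarrow> real" and i j
    define v' where "v' v = v(n := - (\<Sum>i<n. l i * v i))" for v
    have red: "qform n (red X) v = qform (Suc n) X (v' v)" if "X = A \<or> X = B" for X v
      unfolding red_def v'_def last[OF that] qform_rank_update by simp
    have "\<exists>c. \<forall>v. qform n (red B) v \<le> c * qform n (red A) v"
    proof (rule Suc.IH)
      show "psd_form n (red A)" "psd_form n (red B)"
        unfolding psd_form_def using red posA posB by (auto simp: red_def symA symB mult_ac add_ac)
      show "qform n (red B) v = 0" if "qform n (red A) v = 0" for v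
        using that Suc.prems(3) by (simp add: red)
    qed
    then obtain c where c: "\<And>v. qform n (red B) v \<le> c * qform n (red A) v" by blast
    define C where "C = max (2 * c) (2 * B n n / \<alpha>)"
    have "qform (Suc n) B v \<le> C * qform (Suc n) A v" for v
    proof -
      define s where "s = - (\<Sum>i<n. l i * v i)"
      define \<beta> where "\<beta> = v n - s"
      have "(\<Sum>i<n. A i n * v i) = - \<alpha> * s"
        using \<alpha> by (simp add: s_def l_def sum_distrib_left sum_negf)
      then have A: "qform (Suc n) A v = qform n (red A) v + \<alpha> * \<beta> ^ 2"
        using last[of A v "v n"] last[of A v s]
        by (simp add: red v'_def flip: s_def \<alpha>_def) (simp add: \<beta>_def power2_eq_square algebra_simps)
      \<comment> \<open>Parallelogram law for \<open>B\<close>: \<open>v\<close> is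
        \<open>v' v + \<beta> e\<close> and \<open>v(n := s - \<beta>)\<close> agrees with
        \<open>v' v - \<beta> e\<close>. For \<open>A\<close>, orthogonality gave an exact
        splitting.\<close>
      have "qform (Suc n) B v + qform (Suc n) B (v(n := s - \<beta>)) = 2 * qform n (red B) v + 2 * \<beta> ^ 2 * B n n"
        using last[of B v "v n"] last[of B v s] last[of B v "s - \<beta>"]
        by (simp add: red v'_def flip: s_def) (simp add: \<beta>_def power2_eq_square algebra_simps)
      then have "qform (Suc n) B v \<le> 2 * qform n (red B) v + 2 * \<beta> ^ 2 * B n n"
        using posB[of "v(n := s - \<beta>)"] by linarith
      also have "\<dots> \<le> 2 * c * qform n (red A) v + 2 * B n n / \<alpha> * (\<alpha> * \<beta> ^ 2)"
        using c[of v] \<alpha> by simp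
      also have "\<dots> \<le> C * qform n (red A) v + C * (\<alpha> * \<beta> ^ 2)"
        using posA \<alpha> by (intro add_mono mult_right_mono) (auto simp: C_def red)
      also have "\<dots> = C * qform (Suc n) A v" by (simp add: A distrib_left)
      finally show ?thesis .
    qed
    then show ?thesis by blast
  qed
qed

section \<open>Linear matrix inequalities as families of quadratic forms\<close>

lemma psd_iff_psd_form:
  assumes "M \<in> carrier_mat r r"
  shows "psd M \<longleftrightarrow> psd_form r (\<lambda>i j. M $$ (i, j))"
proof -
  have sym: "transpose_mat M = M \<longleftrightarrow> (\<forall>i<r. \<forall>j<r. M $$ (i, j) = M $$ (j, i))"
    using assms by (auto simp: mat_eq_iff)
  have q: "v \<bullet> (M *\<^sub>v v) = qform r (\<lambda>i j. M $$ (i, j)) (($) v)" if "v \<in> carrier_vec r" for v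
    using that assms
    by (auto simp: scalar_prod_def qform_def atLeast0LessThan sum_distrib_left mult_ac intro!: sum.cong)
  have "qform r (\<lambda>i j. M $$ (i, j)) v \<ge> 0" if "\<forall>v\<in>carrier_vec r. v \<bullet> (M *\<^sub>v v) \<ge> 0" for v
  proof -
    have "qform r (\<lambda>i j. M $$ (i, j)) v = qform r (\<lambda>i j. M $$ (i, j)) (($) (vec r v))"
      by (intro qform_cong) auto
    then show ?thesis using that q[of "vec r v"] by (metis vec_carrier)
  qed
  then show ?thesis
    using assms unfolding psd_def psd_form_def sym by (auto simp: q square_mat.simps)
qed

text \<open>The weights have sum 1 but may be negative, so that segments can be prolonged as well as
  points averaged.\<close>

lemma affine_form_combination:
  assumes "affine_form n f" "sum \<mu> I = 1" "\<And>i. i \<in> I \<Longrightarrow> z i \<in> carrier_vec n"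
  shows "f (vec n (\<lambda>j. \<Sum>i\<in>I. \<mu> i * z i $ j)) = (\<Sum>i\<in>I. \<mu> i * f (z i))"
proof -
  obtain a b where a: "a \<in> carrier_vec n" and f: "\<And>z. z \<in> carrier_vec n \<Longrightarrow> f z = a \<bullet> z + b"
    using assms(1) by (auto simp: affine_form_def)
  have "f (vec n (\<lambda>j. \<Sum>i\<in>I. \<mu> i * z i $ j)) = (\<Sum>j<n. \<Sum>i\<in>I. \<mu> i * (a $ j * z i $ j)) + b"
    by (simp add: f scalar_prod_def atLeast0LessThan sum_distrib_left mult_ac)
  also have "\<dots> = (\<Sum>i\<in>I. \<mu> i * (\<Sum>j<n. a $ j * z i $ j)) + (\<Sum>i\<in>I. \<mu> i) * b"
    by (subst sum.swap) (simp add: sum_distrib_left assms(2))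
  also have "\<dots> = (\<Sum>i\<in>I. \<mu> i * ((\<Sum>j<n. a $ j * z i $ j) + b))"
    by (simp add: distrib_left sum.distrib sum_distrib_right)
  also have "\<dots> = (\<Sum>i\<in>I. \<mu> i * f (z i))"
  proof (intro sum.cong refl)
    fix i assume "i \<in> I"
    then have zi: "z i \<in> carrier_vec n" by (rule assms(3))
    then have "dim_vec (z i) = n" by (rule carrier_vecD)
    then show "\<mu> i * ((\<Sum>j<n. a $ j * z i $ j) + b) = \<mu> i * f (z i)"
      by (simp add: f[OF zi] scalar_prod_def atLeast0LessThan)
  qed
  finally show ?thesis .
qed

lemma qform_lmi_combination:
  assumes "lmi_matrix n r M" "sum \<mu> I = 1" "\<And>i. i \<in> I \<Longrightarrow> z i \<in> carrier_vec n"
  shows "qform r (\<lambda>a b. M (vec n (\<lambda>j. \<Sum>i\<in>I. \<mu> i * z i $ j)) $$ (a, b)) v =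
    (\<Sum>i\<in>I. \<mu> i * qform r (\<lambda>a b. M (z i) $$ (a, b)) v)"
proof -
  have "qform r (\<lambda>a b. M (vec n (\<lambda>j. \<Sum>i\<in>I. \<mu> i * z i $ j)) $$ (a, b)) v =
    (\<Sum>a<r. \<Sum>b<r. v a * (\<Sum>i\<in>I. \<mu> i * M (z i) $$ (a, b)) * v b)"
    unfolding qform_def
  proof (intro sum.cong refl)
    fix a b assume "a \<in> {..<r}" "b \<in> {..<r}"
    then have "affine_form n (\<lambda>z. M z $$ (a, b))" using assms(1) by (simp add: lmi_matrix_def)
    then show "v a * M (vec n (\<lambda>j. \<Sum>i\<in>I. \<mu> i * z i $ j)) $$ (a, b) * v b =
        v a * (\<Sum>i\<in>I. \<mu> i * M (z i) $$ (a, b)) * v b"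
      using affine_form_combination[of n "\<lambda>z. M z $$ (a, b)", OF _ assms(2,3)] by simp
  qed
  also have "\<dots> = (\<Sum>a<r. \<Sum>b<r. \<Sum>i\<in>I. \<mu> i * (v a * M (z i) $$ (a, b) * v b))"
    by (simp add: sum_distrib_left sum_distrib_right mult_ac)
  also have "\<dots> = (\<Sum>i\<in>I. \<mu> i * qform r (\<lambda>a b. M (z i) $$ (a, b)) v)"
    by (simp add: qform_def sum_distrib_left sum.swap[of _ I])
  finally show ?thesis .
qed

lemma lmi_psd_form_iff:
  assumes "lmi_matrix n r M" "z \<in> carrier_vec n"
  shows "psd (M z) \<longleftrightarrow> (\<forall>v. qform r (\<lambda>a b. M z $$ (a, b)) v \<ge> 0)"
proof -
  have M: "M z \<in> carrier_mat r r" "transpose_mat (M z) = M z"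
    using assms by (auto simp: lmi_matrix_def)
  then have "M z $$ (i, j) = M z $$ (j, i)" if "i < r" "j < r" for i j
    using that by (metis carrier_matD index_transpose_mat(1))
  then show ?thesis by (auto simp: psd_iff_psd_form[OF M(1)] psd_form_def)
qed

definition spectrahedron :: "nat \<Rightarrow> (real vec \<Rightarrow> real mat) set \<Rightarrow> real vec set" where
  "spectrahedron n \<M> = {z \<in> carrier_vec n. \<forall>M\<in>\<M>. psd (M z)}"

text \<open>Otherwise every matrix at \<open>y\<close> would be dominated by a multiple of the matrix at \<open>x\<close>, so the
  segment from \<open>y\<close> to \<open>x\<close> could be prolonged beyond \<open>x\<close>, where \<open>f\<close> is negative.\<close>

lemma exists_separating_block:
  assumes fin: "finite \<M>" and lmi: "\<And>M. M \<in> \<M> \<Longrightarrow> lmi_matrix n (r M) M"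
    and f: "affine_form n f" "\<And>z. z \<in> spectrahedron n \<M> \<Longrightarrow> f z \<ge> 0"
    and x: "x \<in> spectrahedron n \<M>" "f x = 0" and y: "y \<in> spectrahedron n \<M>" "f y > 0"
  shows "\<exists>M\<in>\<M>. \<exists>v. qform (r M) (\<lambda>a b. M x $$ (a, b)) v = 0 \<and> qform (r M) (\<lambda>a b. M y $$ (a, b)) v \<noteq> 0"
proof (rule ccontr)
  assume neg: "\<not> ?thesis"
  let ?q = "\<lambda>M z. qform (r M) (\<lambda>a b. M z $$ (a, b))"
  have carr: "x \<in> carrier_vec n" "y \<in> carrier_vec n" and
    psd: "\<And>M. M \<in> \<M> \<Longrightarrow> psd (M x) \<and> psd (M y)"
    using x(1) y(1) by (auto simp: spectrahedron_def)
  have "\<exists>c. \<forall>v. ?q M y v \<le> c * ?q M x v" if "M \<in> \<M>" for M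
  proof (rule psd_form_dominated)
    have "M x \<in> carrier_mat (r M) (r M)" "M y \<in> carrier_mat (r M) (r M)"
      using lmi[OF that] carr by (auto simp: lmi_matrix_def)
    then show "psd_form (r M) (\<lambda>a b. M x $$ (a, b))" "psd_form (r M) (\<lambda>a b. M y $$ (a, b))"
      using psd[OF that] by (simp_all add: psd_iff_psd_form)
    show "?q M y v = 0" if "?q M x v = 0" for v using neg that \<open>M \<in> \<M>\<close> by blast
  qed
  then obtain c where c: "\<And>M v. M \<in> \<M> \<Longrightarrow> ?q M y v \<le> c M * ?q M x v" by metis
  define C where "C = Max (insert 1 (c ` \<M>))"
  have C: "C \<ge> 1" "\<And>M. M \<in> \<M> \<Longrightarrow> c M \<le> C" using fin by (auto simp: C_def)
  \<comment> \<open>The weights of \<open>w = x + (x - y) / C\<close>, a point beyond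
    \<open>x\<close> on the line from \<open>y\<close>; \<open>True\<close> stands for
    \<open>x\<close>.\<close>
  define \<mu> where "\<mu> b = (if b then 1 + 1 / C else - 1 / C)" for b
  define w where "w = vec n (\<lambda>j. \<Sum>b\<in>UNIV. \<mu> b * (if b then x else y) $ j)"
  have \<mu>: "sum \<mu> UNIV = 1" by (simp add: \<mu>_def UNIV_bool)
  have qw: "?q M w v = (1 + 1 / C) * ?q M x v - 1 / C * ?q M y v" if "M \<in> \<M>" for M v
    unfolding w_def using carr
    by (subst qform_lmi_combination[OF lmi[OF that] \<mu>]) (auto simp: UNIV_bool \<mu>_def)
  have "?q M w v \<ge> 0" if M: "M \<in> \<M>" for M v
  proof -
    have "?q M x v \<ge> 0" using lmi_psd_form_iff[OF lmi[OF M] carr(1)] psd[OF M] by blast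
    then have "c M * ?q M x v \<le> C * ?q M x v" using C(2)[OF M] by (rule mult_right_mono[rotated])
    then have "?q M y v \<le> C * ?q M x v" using c[OF M, of v] by linarith
    then have "1 / C * ?q M y v \<le> ?q M x v" using C(1) by (simp add: field_simps)
    moreover have "1 / C * ?q M x v \<ge> 0" using \<open>?q M x v \<ge> 0\<close> C(1) by simp
    ultimately show ?thesis by (simp add: qw[OF M] distrib_right)
  qed
  then have "w \<in> spectrahedron n \<M>"
    using lmi_psd_form_iff[OF lmi] by (auto simp: spectrahedron_def w_def)
  then have "f w \<ge> 0" by (rule f(2))
  moreover have "f w = - (1 / C) * f y"
    unfolding w_def using carr x(2)
    by (subst affine_form_combination[OF f(1) \<mu>]) (auto simp: UNIV_bool \<mu>_def)
  moreover have "1 / C * f y > 0" using C(1) y(2) by simp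
  ultimately show False by simp
qed

lemma affine_form_coord: "i < n \<Longrightarrow> affine_form n (\<lambda>z. z $ i)"
  unfolding affine_form_def
  by (intro bexI[of _ "unit_vec n i"] exI[of _ 0]) (auto simp: scalar_prod_left_unit)

lemma affine_form_add:
  assumes "affine_form n f" "affine_form n g"
  shows "affine_form n (\<lambda>z. f z + g z)"
proof -
  obtain a b a' b' where "a \<in> carrier_vec n" "a' \<in> carrier_vec n"
    "\<And>z. z \<in> carrier_vec n \<Longrightarrow> f z = a \<bullet> z + b" "\<And>z. z \<in> carrier_vec n \<Longrightarrow> g z = a' \<bullet> z + b'"
    using assms unfolding affine_form_def by metis
  then show ?thesis
    unfolding affine_form_def
    by (intro bexI[of _ "a + a'"] exI[of _ "b + b'"]) (auto simp: add_scalar_prod_distrib[of _ n])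
qed

lemma affine_form_cmult:
  assumes "affine_form n f"
  shows "affine_form n (\<lambda>z. c * f z)"
proof -
  obtain a b where "a \<in> carrier_vec n" "\<And>z. z \<in> carrier_vec n \<Longrightarrow> f z = a \<bullet> z + b"
    using assms unfolding affine_form_def by metis
  then show ?thesis
    unfolding affine_form_def
    by (intro bexI[of _ "c \<cdot>\<^sub>v a"] exI[of _ "c * b"]) (auto simp: distrib_left)
qed

lemma affine_form_0: "affine_form n (\<lambda>_. 0)"
  unfolding affine_form_def by (intro bexI[of _ "0\<^sub>v n"] exI[of _ 0]) auto

lemma affine_form_sum:
  "(\<And>i. i \<in> I \<Longrightarrow> affine_form n (f i)) \<Longrightarrow> affine_form n (\<lambda>z. \<Sum>i\<in>I. f i z)"
  by (induction I rule: infinite_finite_induct) (auto intro: affine_form_add affine_form_0)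

text \<open>A family of \<open>k + 1\<close> vectors in which every vector is outside the kernel of a form that
  annihilates all later ones is linearly independent, which is impossible in dimension \<open>r \<le> k\<close>.
  Ramsey's theorem provides such a family within a single block.\<close>

lemma no_small_spectrahedron:
  fixes e :: "nat \<Rightarrow> real vec \<Rightarrow> real"
  assumes "k \<ge> 1" and fin: "finite \<M>"
    and lmi: "\<And>M. M \<in> \<M> \<Longrightarrow> lmi_matrix n (r M) M" and r: "\<And>M. M \<in> \<M> \<Longrightarrow> r M \<le> k"
    and e: "\<And>t. affine_form n (e t)" "\<And>t z. z \<in> spectrahedron n \<M> \<Longrightarrow> e t z \<ge> 0"
    and neighborly: "\<And>T. finite T \<Longrightarrow> card T = k \<Longrightarrow> \<exists>z\<in>spectrahedron n \<M>. \<forall>t. e t z = 0 \<longleftrightarrow> t \<in> T"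
  shows False
proof -
  let ?L = "spectrahedron n \<M>" and ?q = "\<lambda>M z. qform (r M) (\<lambda>a b. M z $$ (a, b))"
  have Lcarr: "z \<in> carrier_vec n" if "z \<in> ?L" for z using that by (simp add: spectrahedron_def)
  have qnn: "?q M z v \<ge> 0" if "M \<in> \<M>" "z \<in> ?L" for M z v
    using lmi_psd_form_iff[OF lmi[OF that(1)] Lcarr[OF that(2)]] that by (auto simp: spectrahedron_def)
  have psd: "psd_form (r M) (\<lambda>a b. M z $$ (a, b))" if "M \<in> \<M>" "z \<in> ?L" for M z
    using lmi[OF that(1)] that psd_iff_psd_form[of "M z" "r M"] by (auto simp: spectrahedron_def lmi_matrix_def)
  obtain z where z: "\<And>T. finite T \<Longrightarrow> card T = k \<Longrightarrow> z T \<in> ?L \<and> (\<forall>t. e t (z T) = 0 \<longleftrightarrow> t \<in> T)"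
    using neighborly by metis
  obtain Ms where Ms: "set Ms = \<M>" using fin finite_list by blast
  \<comment> \<open>The colours are the blocks and the coloured sets have \<open>k + 1\<close>
    elements. A homogeneous set of size \<open>2 * k + 1\<close> has room for the
    \<open>k + 1\<close> windows \<open>T j\<close> below.\<close>
  obtain N :: nat where N: "partn_lst {..<N} (replicate (length Ms) (2 * k + 1)) (k + 1)"
    using ramsey_full by blast
  define \<T> where "\<T> t = {T. T \<subseteq> {..<N} \<and> card T = k \<and> t \<in> T}" for t
  have fin\<T>: "finite (\<T> t)" for t
    by (rule finite_subset[of _ "Pow {..<N}"]) (auto simp: \<T>_def)
  have z\<T>: "z T \<in> ?L" "e t (z T) = 0" if "T \<in> \<T> t" for T t
    using that z[of T] finite_subset[of T "{..<N}"] by (auto simp: \<T>_def)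
  \<comment> \<open>The barycentre of the chosen points at which \<open>e t\<close> vanishes. As all
    forms are nonnegative, its kernel in each block lies in the kernels of all these points.\<close>
  define avg where "avg t = vec n (\<lambda>j. \<Sum>T\<in>\<T> t. 1 / card (\<T> t) * z T $ j)" for t
  have \<mu>: "(\<Sum>T\<in>\<T> t. 1 / real (card (\<T> t))) = 1" if "\<T> t \<noteq> {}" for t
    using that fin\<T> by simp
  have q_avg: "?q M (avg t) v = (\<Sum>T\<in>\<T> t. 1 / card (\<T> t) * ?q M (z T) v)"
    if "\<T> t \<noteq> {}" "M \<in> \<M>" for t M v
    unfolding avg_def using z\<T>(1) Lcarr by (intro qform_lmi_combination lmi \<mu> that) blast
  have avgL: "avg t \<in> ?L" if "\<T> t \<noteq> {}" for t
  proof -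
    have "psd (M (avg t))" if M: "M \<in> \<M>" for M
      using lmi_psd_form_iff[OF lmi[OF M], of "avg t"] q_avg[OF \<open>\<T> t \<noteq> {}\<close> M] z\<T>(1) qnn[OF M]
      by (auto simp: avg_def intro!: sum_nonneg)
    then show ?thesis by (simp add: spectrahedron_def avg_def)
  qed
  have e_avg: "e t (avg t) = 0" if "\<T> t \<noteq> {}" for t
  proof -
    have "e t (avg t) = (\<Sum>T\<in>\<T> t. 1 / card (\<T> t) * e t (z T))"
      unfolding avg_def using z\<T>(1) Lcarr by (intro affine_form_combination e(1) \<mu> that) blast
    then show ?thesis by (simp add: z\<T>(2))
  qed
  have avg_kernel: "?q M (z T) v = 0" if "?q M (avg t) v = 0" "T \<in> \<T> t" "M \<in> \<M>" for M t T v
  proof -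
    have ne: "\<T> t \<noteq> {}" using that(2) by auto
    have "(\<Sum>T\<in>\<T> t. 1 / card (\<T> t) * ?q M (z T) v) = 0" using q_avg[OF ne that(3)] that(1) by simp
    then have "1 / card (\<T> t) * ?q M (z T) v = 0"
      using fin\<T> z\<T>(1) qnn[OF that(3)] that(2) by (subst (asm) sum_nonneg_eq_0_iff) auto
    then show ?thesis using ne fin\<T> by simp
  qed
  \<comment> \<open>For \<open>t = Min R\<close>, the form \<open>e t\<close> vanishes at the
    barycentre but is positive at the point belonging to the rest of \<open>R\<close>. The block
    given by \<open>exists_separating_block\<close> becomes the colour of \<open>R\<close>.\<close>
  have "\<exists>c<length Ms. \<exists>v. ?q (Ms ! c) (avg (Min R)) v = 0 \<and> ?q (Ms ! c) (z (R - {Min R})) v \<noteq> 0"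
    if R: "R \<in> nsets {..<N} (k + 1)" for R
  proof -
    have R': "R \<subseteq> {..<N}" "finite R" "card R = k + 1" using R by (auto simp: nsets_def)
    then have MinR: "Min R \<in> R" by (intro Min_in) auto
    have T: "finite (R - {Min R})" "card (R - {Min R}) = k" using R' MinR by auto
    \<comment> \<open>As \<open>k \<ge> 1\<close>, there is a second element; the set
      \<open>R - {u}\<close> shows that the barycentre for \<open>Min R\<close> averages over a
      nonempty family.\<close>
    obtain u where u: "u \<in> R - {Min R}" using T assms(1) by (metis card.empty equals0I not_one_le_zero)
    have "card (R - {u}) = k" using R' u by simp
    then have "R - {u} \<in> \<T> (Min R)" using R' u MinR by (auto simp: \<T>_def)
    then have ne: "\<T> (Min R) \<noteq> {}" by auto
    have "e (Min R) (z (R - {Min R})) > 0"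
      using z[OF T] e(2)[of "z (R - {Min R})" "Min R"] by (metis Diff_iff insertI1 order_le_less)
    then have "\<exists>M\<in>\<M>. \<exists>v. ?q M (avg (Min R)) v = 0 \<and> ?q M (z (R - {Min R})) v \<noteq> 0"
      by (intro exists_separating_block[where n = n and f = "e (Min R)"] fin lmi e avgL[OF ne]
          e_avg[OF ne] conjunct1[OF z[OF T]])
    then obtain M where "M \<in> \<M>"
      and M: "\<exists>v. ?q M (avg (Min R)) v = 0 \<and> ?q M (z (R - {Min R})) v \<noteq> 0" by (rule bexE)
    then have "M \<in> set Ms" using Ms by simp
    then obtain c where "c < length Ms" "Ms ! c = M" unfolding in_set_conv_nth by (elim exE conjE)
    then show ?thesis using M by (intro exI[of _ c]) simp
  qed
  then obtain col where col: "\<And>R. R \<in> nsets {..<N} (k + 1) \<Longrightarrow> col R < length Ms \<and>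
      (\<exists>v. ?q (Ms ! col R) (avg (Min R)) v = 0 \<and> ?q (Ms ! col R) (z (R - {Min R})) v \<noteq> 0)"
    using bchoice[of "nsets {..<N} (k + 1)" "\<lambda>R c. c < length Ms \<and>
      (\<exists>v. ?q (Ms ! c) (avg (Min R)) v = 0 \<and> ?q (Ms ! c) (z (R - {Min R})) v \<noteq> 0)"] by blast
  then have "col \<in> nsets {..<N} (k + 1) \<rightarrow> {..<length Ms}" by auto
  then obtain c H where c: "c < length (replicate (length Ms) (2 * k + 1))"
    and H: "H \<in> nsets {..<N} (replicate (length Ms) (2 * k + 1) ! c)" and mono: "col ` nsets H (k + 1) \<subseteq> {c}"
    using partn_lstE[OF N] by (metis length_replicate)
  have H': "H \<subseteq> {..<N}" "finite H" "card H = 2 * k + 1" using H c by (auto simp: nsets_def)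
  define M where "M = Ms ! c"
  have M: "M \<in> \<M>" using c Ms by (auto simp: M_def)
  define h where "h j = sorted_list_of_set H ! j" for j
  have h_mono: "h i < h j" if "i < j" "j < 2 * k + 1" for i j
    using that H' sorted_wrt_nth_less[OF strict_sorted_list_of_set[of H], of i j] by (simp add: h_def)
  have h_in: "h j \<in> H" if "j < 2 * k + 1" for j
    using that H' nth_mem[of j "sorted_list_of_set H"] by (simp add: h_def)
  have h_inj: "inj_on h {..<2 * k + 1}"
    by (intro linorder_inj_onI) (use h_mono in force)+
  \<comment> \<open>The \<open>k\<close> elements of \<open>H\<close> that follow
    \<open>h j\<close>; for \<open>j \<le> k\<close> their indices are at most
    \<open>2 * k\<close>.\<close>
  define T where "T j = h ` {j<..j + k}" for j
  have cardT: "card (T j) = k" if "j \<le> k" for j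
    unfolding T_def using that by (subst card_image) (auto intro: inj_on_subset[OF h_inj])
  have TN: "T j \<subseteq> {..<N}" if "j \<le> k" for j
  proof -
    have "T j \<subseteq> H" unfolding T_def using that by (auto intro!: h_in)
    then show ?thesis using H'(1) by blast
  qed
  have finT: "finite (T j)" for j by (simp add: T_def)
  have "\<exists>v. ?q M (avg (h j)) v = 0 \<and> ?q M (z (T j)) v \<noteq> 0" if j: "j \<le> k" for j
  proof -
    let ?R = "insert (h j) (T j)"
    have notin: "h j \<notin> T j"
    proof
      assume "h j \<in> T j"
      then obtain l where "j < l" "l \<le> j + k" "h j = h l" by (auto simp: T_def)
      then show False using h_mono[of j l] j by simp
    qed
    have "?R \<subseteq> H" using j by (auto simp: T_def intro: h_in)
    then have R: "?R \<in> nsets H (k + 1)" using cardT[OF j] finT notin by (simp add: nsets_def)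
    then have RN: "?R \<in> nsets {..<N} (k + 1)" using H' by (auto simp: nsets_def)
    have "Min ?R = h j"
      using j finT by (intro Min_eqI) (auto simp: T_def intro!: less_imp_le[OF h_mono])
    moreover have "?R - {h j} = T j" using notin by auto
    moreover have "col ?R = c" using mono R by blast
    ultimately show ?thesis using col[OF RN] by (simp add: M_def)
  qed
  then obtain v where v: "\<And>j. j \<le> k \<Longrightarrow> ?q M (avg (h j)) (v j) = 0 \<and> ?q M (z (T j)) (v j) \<noteq> 0"
    using bchoice[of "{..k}" "\<lambda>j v. ?q M (avg (h j)) v = 0 \<and> ?q M (z (T j)) v \<noteq> 0"] by auto
  \<comment> \<open>\<open>h l\<close> belongs to the window \<open>T j\<close>, so a kernel vector
    at \<open>avg (h l)\<close> is also one at \<open>z (T j)\<close>.\<close>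
  have later: "?q M (z (T j)) (v l) = 0" if "j < l" "l \<le> k" for j l
  proof (rule avg_kernel[OF _ _ M])
    show "?q M (avg (h l)) (v l) = 0" using v that by simp
    have "l \<in> {j<..j + k}" using that by auto
    then show "T j \<in> \<T> (h l)" using that cardT[of j] TN[of j] by (auto simp: \<T>_def T_def)
  qed
  have "r M < card {..k}" using r[OF M] by simp
  then obtain a where a: "\<exists>j\<in>{..k}. a j \<noteq> 0" "\<And>i. i < r M \<Longrightarrow> (\<Sum>j\<in>{..k}. a j * v j i) = 0"
    by (rule underdetermined_system[OF finite_atMost, of "r M" k "\<lambda>i j. v j i"]) blast
  \<comment> \<open>The first nonzero coefficient expresses \<open>v j\<close> through later
    vectors, which are all annihilated at \<open>z (T j)\<close>, whereas \<open>v j\<close> is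
    not.\<close>
  define j where "j = (LEAST j. j \<le> k \<and> a j \<noteq> 0)"
  have "\<exists>j. j \<le> k \<and> a j \<noteq> 0" using a(1) by auto
  then have j: "j \<le> k" "a j \<noteq> 0" unfolding j_def by (metis (mono_tags, lifting) LeastI)+
  have least: "a i = 0" if "i < j" for i
    using not_less_Least[of i "\<lambda>j. j \<le> k \<and> a j \<noteq> 0"] that j(1) by (simp add: j_def)
  let ?Q = "?q M (z (T j))"
  have zL: "z (T j) \<in> ?L" using z[OF finT cardT[OF j(1)]] by blast
  have "a j * v j i = (\<Sum>l\<in>{j<..k}. - a l * v l i)" if "i < r M" for i
  proof -
    have "(\<Sum>l\<in>{..k}. a l * v l i) = (\<Sum>l\<in>insert j {j<..k}. a l * v l i)"
      using j least by (intro sum.mono_neutral_right) (auto simp: not_less le_less)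
    then show ?thesis using a(2)[OF that] by (simp add: sum_negf)
  qed
  then have "?Q (\<lambda>i. a j * v j i) = ?Q (\<lambda>i. \<Sum>l\<in>{j<..k}. - a l * v l i)"
    by (intro qform_cong) auto
  also have "\<dots> = 0" using later by (intro qform_sum_eq_0 psd M zL) auto
  finally show False using v[OF j(1)] j(2) by (simp add: qform_scale)
qed

section \<open>Gram matrices\<close>

text \<open>The form \<open>g\<close> in the monomials \<open>1, X, ..., X^k\<close>; a symmetric
  \<open>g\<close> is a Gram matrix of this polynomial.\<close>

definition gram_poly :: "nat \<Rightarrow> (nat \<Rightarrow> nat \<Rightarrow> real) \<Rightarrow> real poly" where
  "gram_poly k g = (\<Sum>a<k + 1. \<Sum>b<k + 1. monom (g a b) (a + b))"

text \<open>Leading terms of squares cannot cancel: at twice the largest degree \<open>D\<close> the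
  coefficient is a sum of squares of real numbers, not all zero.\<close>

lemma degree_le_of_sum_squares:
  assumes "degree (\<Sum>q\<leftarrow>qs. q ^ 2) \<le> 2 * k" "q \<in> set qs"
  shows "degree (q :: real poly) \<le> k"
proof (rule ccontr)
  assume neg: "\<not> degree q \<le> k"
  define D where "D = Max (degree ` set qs)"
  have D: "degree p \<le> D" if "p \<in> set qs" for p using that by (simp add: D_def)
  have "D \<in> degree ` set qs" unfolding D_def using assms(2) by (intro Max_in) auto
  then obtain p where p: "p \<in> set qs" "degree p = D" by auto
  have "D > k" using D[OF assms(2)] neg by simp
  have sq: "coeff (p ^ 2) (2 * D) = coeff p D ^ 2" if "p \<in> set qs" for p
  proof (cases "degree p = D")
    case True
    then show ?thesis using coeff_mult_degree_sum[of p p] by (simp add: power2_eq_square mult_2)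
  next
    case False
    then have "degree p < D" using D[OF that] by simp
    moreover from this have "degree (p ^ 2) < 2 * D"
      using degree_power_le[of p 2] by simp
    ultimately show ?thesis by (simp add: coeff_eq_0)
  qed
  have "coeff (\<Sum>q\<leftarrow>rs. q ^ 2) n = (\<Sum>q\<leftarrow>rs. coeff (q ^ 2) n)" for rs :: "real poly list" and n
    by (induction rs) auto
  then have "coeff (\<Sum>q\<leftarrow>qs. q ^ 2) (2 * D) = (\<Sum>q\<leftarrow>qs. coeff q D ^ 2)"
    using sq by (simp cong: map_cong)
  moreover have "coeff (\<Sum>q\<leftarrow>qs. q ^ 2) (2 * D) = 0"
    using assms(1) \<open>D > k\<close> by (intro coeff_eq_0) simp
  ultimately have "(\<Sum>q\<leftarrow>qs. coeff q D ^ 2) = 0" by (rule trans[OF sym])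
  then have "\<forall>x\<in>set (map (\<lambda>q. coeff q D ^ 2) qs). x = 0"
    by (subst (asm) sum_list_nonneg_eq_0_iff) auto
  then have "coeff p D = 0" using p(1) by simp
  then show False using p(2) \<open>D > k\<close> by (metis leading_coeff_0_iff degree_0 not_less_zero)
qed

lemma gram_poly_square:
  assumes "degree q \<le> k"
  shows "gram_poly k (\<lambda>a b. coeff q a * coeff q b) = q ^ 2"
proof -
  have q: "(\<Sum>a<k + 1. monom (coeff q a) a) = q"
    using poly_as_sum_of_monoms'[OF assms] by (simp only: Suc_eq_plus1[symmetric] lessThan_Suc_atMost)
  have "gram_poly k (\<lambda>a b. coeff q a * coeff q b) =
      (\<Sum>a<k + 1. monom (coeff q a) a) * (\<Sum>b<k + 1. monom (coeff q b) b)"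
    by (simp only: gram_poly_def sum_product mult_monom)
  then show ?thesis by (simp only: q power2_eq_square)
qed

text \<open>Each square contributes the rank-one matrix of products of its coefficients, which fits
  the size because of \<open>degree_le_of_sum_squares\<close>.\<close>

lemma sos_polys_gram:
  assumes "\<sigma> \<in> sos_polys (2 * k)"
  obtains g where "psd_form (k + 1) g" "\<sigma> = gram_poly k g"
proof -
  obtain qs where \<sigma>: "\<sigma> = (\<Sum>q\<leftarrow>qs. q ^ 2)" and deg: "degree \<sigma> \<le> 2 * k"
    using assms unfolding sos_polys_def by blast
  have "\<forall>q\<in>set qs. degree q \<le> k" using degree_le_of_sum_squares deg \<sigma> by blast
  then have "\<exists>g. psd_form (k + 1) g \<and> (\<Sum>q\<leftarrow>qs. q ^ 2) = gram_poly k g"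
  proof (induction qs)
    case Nil
    then show ?case
      by (intro exI[of _ "\<lambda>_ _. 0"]) (auto simp: psd_form_def qform_def gram_poly_def)
  next
    case (Cons q qs)
    then obtain g where g: "psd_form (k + 1) g" "(\<Sum>q\<leftarrow>qs. q ^ 2) = gram_poly k g" by auto
    let ?g = "\<lambda>a b. coeff q a * coeff q b + g a b"
    have "qform (k + 1) ?g v = (\<Sum>a<k + 1. v a * coeff q a) ^ 2 + qform (k + 1) g v" for v
      by (simp only: qform_def power2_eq_square sum_product distrib_left distrib_right sum.distrib mult_ac)
    then have "psd_form (k + 1) ?g" using g(1) by (auto simp: psd_form_def mult_ac)
    moreover have "gram_poly k ?g = gram_poly k (\<lambda>a b. coeff q a * coeff q b) + gram_poly k g"
      by (simp only: gram_poly_def sum.distrib flip: add_monom)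
    ultimately show ?case using Cons.prems g(2) by (intro exI[of _ ?g]) (simp add: gram_poly_square)
  qed
  then show thesis using that \<sigma> by blast
qed

lemma degree_gram_poly: "degree (gram_poly k g) \<le> 2 * k"
proof (intro degree_le allI impI)
  fix i assume "2 * k < i"
  then show "coeff (gram_poly k g) i = 0"
    unfolding gram_poly_def coeff_sum coeff_monom by (intro sum.neutral ballI) auto
qed

lemma poly_gram_poly: "poly (gram_poly k g) x = qform (k + 1) g (\<lambda>a. x ^ a)"
  by (simp only: gram_poly_def qform_def poly_sum poly_monom power_add mult_ac)

text \<open>In the backward direction, \<open>gram_poly k (g i)\<close> is nonnegative, its values
  being those of the form at vectors of powers of \<open>x\<close>, and
  \<open>shifted_nonneg_in_SOCF\<close> applies.\<close>

lemma SOCF_iff_gram: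
  assumes "d > 2 * k"
  shows "p \<in> SOCF (2 * k + 1) d \<longleftrightarrow>
    (\<exists>g. (\<forall>i<d - 2 * k + 1. psd_form (k + 1) (g i)) \<and> p = (\<Sum>i<d - 2 * k + 1. [:0, 1:] ^ i * gram_poly k (g i)))"
    (is "_ \<longleftrightarrow> ?R")
proof
  assume "p \<in> SOCF (2 * k + 1) d"
  then obtain \<sigma> where p: "p = (\<Sum>i = 0..d - 2 * k. [:0, 1:] ^ i * \<sigma> i)"
    and \<sigma>: "\<forall>i\<le>d - 2 * k. \<sigma> i \<in> sos_polys (2 * k)"
    unfolding SOCF_eq_shifted_sos[OF assms] shifted_sos_iff by blast
  have "\<exists>g. psd_form (k + 1) g \<and> \<sigma> i = gram_poly k g" if "i \<le> d - 2 * k" for i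
    using sos_polys_gram[of "\<sigma> i" k] \<sigma> that by blast
  then obtain g where "\<And>i. i \<le> d - 2 * k \<Longrightarrow> psd_form (k + 1) (g i) \<and> \<sigma> i = gram_poly k (g i)"
    using bchoice[of "{..d - 2 * k}" "\<lambda>i g. psd_form (k + 1) g \<and> \<sigma> i = gram_poly k g"] by auto
  then show ?R
    unfolding p by (intro exI[of _ g]) (auto simp: atLeast0AtMost simp flip: lessThan_Suc_atMost)
next
  assume ?R
  then obtain g where g: "\<And>i. i < d - 2 * k + 1 \<Longrightarrow> psd_form (k + 1) (g i)"
    and p: "p = (\<Sum>i<d - 2 * k + 1. [:0, 1:] ^ i * gram_poly k (g i))" by blast
  have "poly (gram_poly k (g i)) x \<ge> 0" if "i < d - 2 * k + 1" for i x
    unfolding poly_gram_poly using g[OF that] by (simp add: psd_form_def)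
  then show "p \<in> SOCF (2 * k + 1) d"
    unfolding p using assms by (intro SOCF_sum shifted_nonneg_in_SOCF degree_gram_poly) auto
qed

lemma coeff_shifted_gram:
  "coeff (\<Sum>i<n. [:0, 1:] ^ i * gram_poly k (g i)) j =
    (\<Sum>i<n. \<Sum>a<k + 1. \<Sum>b<k + 1. if i + a + b = j then g i a b else 0)"
proof -
  have X: "[:0, 1:] ^ i = monom (1 :: real) i" for i by (simp add: monom_altdef)
  have "[:0, 1:] ^ i * gram_poly k (g i) = (\<Sum>a<k + 1. \<Sum>b<k + 1. monom (g i a b) (i + a + b))" for i
    unfolding gram_poly_def sum_distrib_left X by (simp only: mult_monom mult_1 add.assoc)
  then show ?thesis by (simp only: coeff_sum coeff_monom)
qed

lemma degree_SOCF:
  assumes "p \<in> SOCF n d" "i > d"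
  shows "coeff p i = 0"
proof -
  obtain f where p: "p = (\<Sum>J | J \<subseteq> {0..d} \<and> card J = n. f J)"
    and f: "\<forall>J. J \<subseteq> {0..d} \<and> card J = n \<longrightarrow> f J \<in> CP J"
    using assms(1) unfolding SOCF_iff by blast
  have "coeff (f J) i = 0" if "J \<subseteq> {0..d}" "card J = n" for J
  proof -
    have "i \<notin> J" using that(1) assms(2) by auto
    moreover have "f J \<in> CP J" using f that by blast
    ultimately show ?thesis by (simp add: CP_iff)
  qed
  then show ?thesis unfolding p by (simp add: coeff_sum)
qed

lemma poly_SOCF_nonneg:
  assumes "p \<in> SOCF n d" "x \<ge> 0"
  shows "poly p x \<ge> 0"
proof -
  obtain f where p: "p = (\<Sum>J | J \<subseteq> {0..d} \<and> card J = n. f J)"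
    and f: "\<forall>J. J \<subseteq> {0..d} \<and> card J = n \<longrightarrow> f J \<in> CP J"
    using assms(1) unfolding SOCF_iff by blast
  show ?thesis unfolding p poly_sum using f assms(2) by (intro sum_nonneg) (auto simp: CP_def)
qed

section \<open>The semidefinite extension degree\<close>

text \<open>The lifting variables are the entries of \<open>d - 2 * k + 1\<close> Gram matrices. The
  blocks are these matrices, of size \<open>k + 1\<close>, and pairs of blocks of size 1 expressing
  the equations for the coefficients.\<close>

lemma lifted_sd_rep_SOCF:
  assumes "d > 2 * k"
  shows "lifted_sd_rep (d + 1) (coeff_vec d ` SOCF (2 * k + 1) d) (k + 1)"
proof -
  define n where "n = d - 2 * k + 1"
  define K where "K = k + 1"
  define m where "m = n * K * K"
  \<comment> \<open>Position of the entry \<open>(a, b)\<close> of matrix \<open>i\<close> among the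
    lifting variables; \<open>div\<close> and \<open>mod\<close> by \<open>K\<close> recover the
    three indices.\<close>
  define off where "off i a b = (i * K + a) * K + b" for i a b
  have digit: "x * K + c < y * K" if "x < y" "c < K" for x c y
  proof -
    have "x * K + c < Suc x * K" using that(2) by simp
    also have "\<dots> \<le> y * K" using that(1) by (intro mult_le_mono1) simp
    finally show ?thesis .
  qed
  have off_less: "off i a b < m" if "i < n" "a < K" "b < K" for i a b
  proof -
    have "i * K + a < n * K" using that by (intro digit)
    then show ?thesis unfolding off_def m_def using that(3) by (rule digit)
  qed
  have off_div: "off i a b div K div K = i" "off i a b div K mod K = a" "off i a b mod K = b"
    if "a < K" "b < K" for i a b
    using that by (simp_all add: off_def)
  \<comment> \<open>The shift by \<open>d + 1\<close> skips the coordinates of \<open>x\<close>.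
    Reading at \<open>min\<close> and \<open>max\<close> makes the matrices symmetric for all values
    of the variables, as \<open>lmi_matrix\<close> demands.\<close>
  define ent where "ent z i a b = z $ (d + 1 + off i (min a b) (max a b))" for z :: "real vec" and i a b
  define G where "G i z = mat K K (\<lambda>(a, b). ent z i a b)" for i z
  define con where "con j z = z $ j - (\<Sum>i<n. \<Sum>a<K. \<Sum>b<K. if i + a + b = j then ent z i a b else 0)" for j z
  \<comment> \<open>The two blocks with \<open>s = 1\<close> and \<open>s = - 1\<close> together
    force \<open>con j z = 0\<close>.\<close>
  define C where "C s j z = mat 1 1 (\<lambda>_. s * con j z)" for s j z
  define Ms where "Ms = map G [0..<n] @ map (C 1) [0..<d + 1] @ map (C (- 1)) [0..<d + 1]"
  have set_Ms: "set Ms = G ` {..<n} \<union> C 1 ` {..<d + 1} \<union> C (- 1) ` {..<d + 1}"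
    by (simp only: Ms_def set_append set_map set_upt atLeast0LessThan Un_assoc)
  have ent_aff: "affine_form (d + 1 + m) (\<lambda>z. ent z i a b)" if "i < n" "a < K" "b < K" for i a b
    unfolding ent_def using off_less[of i "min a b" "max a b"] that
    by (intro affine_form_coord) (simp add: min_def max_def)
  have con_aff: "affine_form (d + 1 + m) (con j)" if "j < d + 1" for j
  proof -
    have "affine_form (d + 1 + m) (\<lambda>z. if i + a + b = j then ent z i a b else 0)" if "i < n" "a < K" "b < K" for i a b
      using ent_aff[OF that] affine_form_0 by (cases "i + a + b = j") auto
    then have "affine_form (d + 1 + m)
      (\<lambda>z. z $ j + (- 1) * (\<Sum>i<n. \<Sum>a<K. \<Sum>b<K. if i + a + b = j then ent z i a b else 0))"
      using that by (intro affine_form_add affine_form_cmult affine_form_sum affine_form_coord) auto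
    then show ?thesis by (simp add: con_def[abs_def])
  qed
  have "\<exists>r\<le>K. lmi_matrix (d + 1 + m) r M" if M: "M \<in> set Ms" for M
  proof -
    consider i where "i < n" "M = G i" | s j where "j < d + 1" "M = C s j"
      using M unfolding set_Ms by blast
    then show ?thesis
    proof cases
      case 1
      then have "lmi_matrix (d + 1 + m) K M"
        using ent_aff by (auto simp: lmi_matrix_def G_def ent_def min.commute max.commute)
      then show ?thesis by blast
    next
      case 2
      then have "lmi_matrix (d + 1 + m) 1 M"
        using con_aff by (auto simp: lmi_matrix_def C_def intro!: affine_form_cmult eq_matI)
      then show ?thesis by (auto simp: K_def)
    qed
  qed
  moreover have psd_G: "psd (G i z) \<longleftrightarrow> psd_form K (ent z i)" for i z
    by (subst psd_iff_psd_form[of _ K])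
      (auto simp: G_def psd_form_def ent_def min.commute max.commute cong: qform_cong)
  have psd_C: "psd (C s j z) \<longleftrightarrow> s * con j z \<ge> 0" for s j z
  proof -
    have "psd (C s j z) \<longleftrightarrow> (\<forall>v :: nat \<Rightarrow> real. s * con j z * v 0 ^ 2 \<ge> 0)"
      by (subst psd_iff_psd_form[of _ 1]) (auto simp: C_def psd_form_def qform_def power2_eq_square mult_ac)
    also have "\<dots> \<longleftrightarrow> s * con j z \<ge> 0"
    proof
      assume "\<forall>v :: nat \<Rightarrow> real. s * con j z * v 0 ^ 2 \<ge> 0"
      from spec[OF this, of "\<lambda>_. 1"] show "s * con j z \<ge> 0" by simp
    qed (metis mult_nonneg_nonneg zero_le_power2)
    finally show ?thesis .
  qed
  have psd_all: "(\<forall>M\<in>set Ms. psd (M z)) \<longleftrightarrow> (\<forall>i<n. psd_form K (ent z i)) \<and> (\<forall>j<d + 1. con j z = 0)" for z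
  proof -
    have "con j z = 0 \<longleftrightarrow> psd (C 1 j z) \<and> psd (C (- 1) j z)" for j
      unfolding psd_C by linarith
    then show ?thesis unfolding set_Ms psd_G[symmetric] by blast
  qed
  have SOCF_gram: "p \<in> SOCF (2 * k + 1) d \<longleftrightarrow>
      (\<exists>g. (\<forall>i<n. psd_form K (g i)) \<and> p = (\<Sum>i<n. [:0, 1:] ^ i * gram_poly k (g i)))" for p
    unfolding n_def K_def by (rule SOCF_iff_gram[OF assms])
  have "coeff_vec d ` SOCF (2 * k + 1) d =
      {x\<in>carrier_vec (d + 1). \<exists>y\<in>carrier_vec m. \<forall>M\<in>set Ms. psd (M (x @\<^sub>v y))}"
  proof (intro equalityI subsetI)
    fix x assume "x \<in> coeff_vec d ` SOCF (2 * k + 1) d"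
    then obtain p where p: "p \<in> SOCF (2 * k + 1) d" and xp: "x = coeff_vec d p" by blast
    obtain g where g: "\<And>i. i < n \<Longrightarrow> psd_form K (g i)"
      and pg: "p = (\<Sum>i<n. [:0, 1:] ^ i * gram_poly k (g i))"
      using p unfolding SOCF_gram by blast
    have x: "x \<in> carrier_vec (d + 1)" "\<And>j. j < d + 1 \<Longrightarrow> x $ j = coeff p j"
      by (simp_all add: xp coeff_vec_def)
    define y where "y = vec m (\<lambda>p. g (p div K div K) (p div K mod K) (p mod K))"
    have ent: "ent (x @\<^sub>v y) i a b = g i a b" if "i < n" "a < K" "b < K" for i a b
    proof -
      have "ent (x @\<^sub>v y) i a b = g i (min a b) (max a b)"
        using off_less[of i "min a b" "max a b"] off_div[of "min a b" "max a b" i] that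
        using x(1) that by (simp add: ent_def y_def)
      then show ?thesis using g[OF that(1)] that by (auto simp: psd_form_def min_def max_def)
    qed
    have "con j (x @\<^sub>v y) = 0" if "j < d + 1" for j
    proof -
      have "(\<Sum>i<n. \<Sum>a<K. \<Sum>b<K. if i + a + b = j then ent (x @\<^sub>v y) i a b else 0) = coeff p j"
        unfolding pg coeff_shifted_gram K_def[symmetric] by (intro sum.cong refl) (simp add: ent)
      then show ?thesis using x that by (simp add: con_def)
    qed
    moreover have "psd_form K (ent (x @\<^sub>v y) i)" if "i < n" for i
    proof -
      have "qform K (ent (x @\<^sub>v y) i) v = qform K (g i) v" for v
        using ent[OF that] by (intro qform_cong) auto
      then show ?thesis using g[OF that] ent[OF that] by (auto simp: psd_form_def)
    qed
    ultimately show "x \<in> {x\<in>carrier_vec (d + 1). \<exists>y\<in>carrier_vec m. \<forall>M\<in>set Ms. psd (M (x @\<^sub>v y))}"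
      unfolding psd_all using x(1) by (intro CollectI conjI bexI[of _ y]) (auto simp: y_def)
  next
    fix x assume "x \<in> {x\<in>carrier_vec (d + 1). \<exists>y\<in>carrier_vec m. \<forall>M\<in>set Ms. psd (M (x @\<^sub>v y))}"
    then obtain y where x: "x \<in> carrier_vec (d + 1)" and y: "y \<in> carrier_vec m"
      and *: "\<And>i. i < n \<Longrightarrow> psd_form K (ent (x @\<^sub>v y) i)" "\<And>j. j < d + 1 \<Longrightarrow> con j (x @\<^sub>v y) = 0"
      unfolding psd_all by blast
    define p where "p = (\<Sum>i<n. [:0, 1:] ^ i * gram_poly k (ent (x @\<^sub>v y) i))"
    have "p \<in> SOCF (2 * k + 1) d"
      unfolding SOCF_gram p_def using *(1) by blast
    moreover have "x $ j = coeff p j" if "j < d + 1" for j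
    proof -
      have "coeff p j = (\<Sum>i<n. \<Sum>a<K. \<Sum>b<K. if i + a + b = j then ent (x @\<^sub>v y) i a b else 0)"
        unfolding p_def coeff_shifted_gram K_def ..
      then show ?thesis using *(2)[OF that] that x y by (simp add: con_def)
    qed
    then have "x = coeff_vec d p"
      using x by (intro eq_vecI) (auto simp: coeff_vec_def)
    ultimately show "x \<in> coeff_vec d ` SOCF (2 * k + 1) d" by blast
  qed
  ultimately show ?thesis
    unfolding lifted_sd_rep_def K_def by blast
qed

text \<open>The linear forms given to \<open>no_small_spectrahedron\<close> are the evaluations at
  natural numbers, read off the first \<open>d + 1\<close> coordinates of a point of the
  lift.\<close>

lemma not_lifted_sd_rep_SOCF:
  assumes "k \<ge> 1" "d > 2 * k" "s \<le> k"
  shows "\<not> lifted_sd_rep (d + 1) (coeff_vec d ` SOCF (2 * k + 1) d) s"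
proof
  assume "lifted_sd_rep (d + 1) (coeff_vec d ` SOCF (2 * k + 1) d) s"
  then obtain m Ms where Ms: "\<forall>M\<in>set Ms. \<exists>r\<le>s. lmi_matrix (d + 1 + m) r M"
    and C: "coeff_vec d ` SOCF (2 * k + 1) d =
      {x\<in>carrier_vec (d + 1). \<exists>y\<in>carrier_vec m. \<forall>M\<in>set Ms. psd (M (x @\<^sub>v y))}"
    unfolding lifted_sd_rep_def by blast
  obtain r where r: "\<And>M. M \<in> set Ms \<Longrightarrow> r M \<le> s \<and> lmi_matrix (d + 1 + m) (r M) M" using Ms by metis
  let ?L = "spectrahedron (d + 1 + m) (set Ms)"
  define e where "e t z = (\<Sum>j<d + 1. real t ^ j * z $ j)" for t :: nat and z :: "real vec"
  have e_poly: "e t (coeff_vec d p @\<^sub>v y) = poly p (real t)" if "p \<in> SOCF (2 * k + 1) d" for t p y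
  proof -
    have "degree p \<le> d" using degree_SOCF[OF that] by (intro degree_le) auto
    then have "poly p (real t) = (\<Sum>j\<le>d. coeff p j * real t ^ j)"
      by (subst poly_as_sum_of_monoms'[of p d, symmetric]) (simp_all add: poly_sum poly_monom)
    then show ?thesis by (simp add: e_def coeff_vec_def lessThan_Suc_atMost mult_ac)
  qed
  show False
  proof (rule no_small_spectrahedron[of k "set Ms" "d + 1 + m" r e])
    show "affine_form (d + 1 + m) (e t)" for t
      unfolding e_def[abs_def] by (intro affine_form_sum affine_form_cmult affine_form_coord) auto
    show "e t z \<ge> 0" if z: "z \<in> ?L" for t z
    proof -
      have "z = vec_first z (d + 1) @\<^sub>v vec_last z m"
        using z by (intro vec_first_last_append[symmetric]) (simp add: spectrahedron_def)
      moreover from this have "vec_first z (d + 1) \<in> coeff_vec d ` SOCF (2 * k + 1) d"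
        using z unfolding C spectrahedron_def by (auto intro!: bexI[of _ "vec_last z m"])
      then obtain p where "p \<in> SOCF (2 * k + 1) d" "vec_first z (d + 1) = coeff_vec d p" by auto
      ultimately show ?thesis by (metis e_poly poly_SOCF_nonneg of_nat_0_le_iff)
    qed
    show "\<exists>z\<in>?L. \<forall>t. e t z = 0 \<longleftrightarrow> t \<in> T" if T: "finite T" "card T = k" for T
    proof -
      \<comment> \<open>A square of degree \<open>2 * k\<close>, hence in the cone, which vanishes
        at a natural number exactly if that number is in \<open>T\<close>.\<close>
      define p where "p = (\<Prod>u\<in>T. [:- real u, 1:]) ^ 2"
      have "degree (\<Prod>u\<in>T. [:- real u, 1:]) = k" using T by (subst degree_prod_eq_sum_degree) auto
      then have "degree p \<le> 2 * k" unfolding p_def using degree_power_le[of _ 2] by (metis mult.commute)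
      then have "[:0, 1:] ^ 0 * p \<in> SOCF (2 * k + 1) d"
        using assms(2) by (intro shifted_nonneg_in_SOCF) (auto simp: p_def)
      then have p: "p \<in> SOCF (2 * k + 1) d" by simp
      then obtain y where y: "coeff_vec d p \<in> carrier_vec (d + 1)" "y \<in> carrier_vec m"
        "\<forall>M\<in>set Ms. psd (M (coeff_vec d p @\<^sub>v y))"
        using C by blast
      have "e t (coeff_vec d p @\<^sub>v y) = 0 \<longleftrightarrow> t \<in> T" for t
        using T(1) unfolding e_poly[OF p] by (auto simp: p_def poly_prod)
      moreover have "coeff_vec d p @\<^sub>v y \<in> ?L"
        using y append_carrier_vec[OF y(1,2)] by (simp add: spectrahedron_def)
      ultimately show ?thesis by blast
    qed
  qed (use r assms order_trans in \<open>blast+\<close>)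
qed

theorem corollary4p1:
  fixes k d :: nat
  assumes "k \<ge> 1" and "d \<ge> 1" and "d > 2 * k"
  shows "SOCF (2 * k + 1) d = (\<Sum>i = 0..d - 2 * k. [:0, 1:] ^ i *o sos_polys (2 * k)) \<and>
    sxdeg (d + 1) (coeff_vec d ` SOCF (2 * k + 1) d) = enat (k + 1)"
proof
  show "SOCF (2 * k + 1) d = (\<Sum>i = 0..d - 2 * k. [:0, 1:] ^ i *o sos_polys (2 * k))"
    using SOCF_eq_shifted_sos[OF assms(3)] by (simp add: shifted_sos_def)
  have "k + 1 \<le> s" if "lifted_sd_rep (d + 1) (coeff_vec d ` SOCF (2 * k + 1) d) s" for s
    using not_lifted_sd_rep_SOCF[OF assms(1,3)] that by (metis Suc_eq_plus1 not_less_eq_eq)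
  then show "sxdeg (d + 1) (coeff_vec d ` SOCF (2 * k + 1) d) = enat (k + 1)"
    unfolding sxdeg_def using lifted_sd_rep_SOCF[OF assms(3)]
    by (intro antisym INF_lower INF_greatest) auto
qed

end
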